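(* Let $(\Lambda,\leq)$ be a non-empty partially ordered set, $R$ a ring with $1\ne0$, $F$ a field, $\lambda:R^+\to F^*$ a right primitive linear character and $(\alpha,\beta)\in\Phi$. Suppose the interval $\{\gamma\in\Lambda:\alpha<\gamma<\beta\}$ of $\Lambda$ is infinite. Then there is an uncountable family of pairwise non-isomorphic irreducible $M^{\alpha\beta}$-modules lying over $\lambda$ such that: all members are completely reducible upon restriction to $M([\alpha,\downarrow,\beta])$; no member is completely reducible upon restriction to $M([\alpha,\rightarrow,\beta])$; and therefore no member has irreducible submodules upon restriction to the normal subgroup $M([\alpha,\rightarrow,\beta])$ of $M^{\alpha\beta}$.
   Context: $\Phi=\{(\alpha,\beta)\in\Lambda\times\Lambda:\alpha<\beta\}$. $J$ is the free left $R$-module with basis $e_{\alpha\beta}$, $(\alpha,\beta)\in\Phi$ ($R$ not necessarily commutative or finite), made into a ring by $(re_{\alpha\beta})(se_{\beta\gamma})=rs\,e_{\alpha\gamma}$ and $(re_{\alpha\beta})(se_{\gamma\delta})=0$ if $\beta\neq\gamma$, extended additively. $J$ is nil, and $M=\{1+x:x\in J\}$ is a group under multiplication (the McLain group). $M_{\alpha\beta}=\{1+re_{\alpha\beta}:r\in R\}$. For a closed subset $\Delta\subseteq\Phi$ (i.e. $(\alpha,\beta),(\beta,\gamma)\in\Delta$ implies $(\alpha,\gamma)\in\Delta$), $M(\Delta)=\langle M_{\alpha\beta}:(\alpha,\beta)\in\Delta\rangle$. Fix $(\alpha,\beta)\in\Phi$. Let $[\alpha,\downarrow,\beta]=\{(\gamma,\beta):\alpha\le\gamma<\beta\}$,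 $[\alpha,\rightarrow,\beta]=\{(\alpha,\gamma):\alpha<\gamma\le\beta\}$ and $M^{\alpha\beta}=M([\alpha,\downarrow,\beta])M([\alpha,\rightarrow,\beta])$. A group homomorphism $\lambda:R^+\to F^*$ is right primitive if the only right ideal of $R$ contained in its kernel is $(0)$. An $M^{\alpha\beta}$-module lies over $\lambda$ if its restriction to $M_{\alpha\beta}$ has a $1$-dimensional submodule on which $1+re_{\alpha\beta}$ acts as $\lambda(r)$ for all $r\in R$. Modules are over $F$ and may be infinite dimensional; completely reducible means direct sum of irreducible submodules. *)

theory Defs
  imports
    Complex_Main
    "HOL-Algebra.Generated_Groups"
    "HOL-Library.Poly_Mapping"
    "HOL-Library.Countable_Set"
begin

section \<open>The McLain group\<close>

text \<open>
  The poset \<open>\<Lambda>\<close> is the type \<open>'l\<close> and the ring \<open>R\<close> is the type \<open>'r\<close>.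
  Elements of \<open>J\<close> and of \<open>M\<close> are \<open>\<Lambda> \<times> \<Lambda>\<close> matrices, the \<open>(a, b)\<close> entry of an element of
  \<open>J\<close> being its coefficient at the basis vector \<open>e\<^sub>a\<^sub>b\<close>.
  The element \<open>1\<close> of \<open>M\<close> is the identity matrix.
\<close>

type_synonym ('l, 'r) mat = "'l \<Rightarrow> 'l \<Rightarrow> 'r"

definition Phi :: "('l::order \<times> 'l) set" where
  "Phi = {(a, b). a < b}"

definition mclain_J :: "('l::order, 'r::ring_1) mat set" where
  "mclain_J = {x. finite {(a, b). x a b \<noteq> 0} \<and> {(a, b). x a b \<noteq> 0} \<subseteq> Phi}"

definition mat_one :: "('l, 'r::ring_1) mat" where
  "mat_one = (\<lambda>a b. if a = b then 1 else 0)"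

definition mat_add :: "('l, 'r::ring_1) mat \<Rightarrow> ('l, 'r) mat \<Rightarrow> ('l, 'r) mat" where
  "mat_add x y = (\<lambda>a b. x a b + y a b)"

text \<open>
  \<open>Sum_any\<close> adds up the nonzero terms (and is \<open>0\<close> if there are infinitely many of them).
  For elements of \<open>J\<close> or \<open>M\<close> there are only finitely many, as every row of such
  an element has finite support.
\<close>

definition mat_mult :: "('l, 'r::ring_1) mat \<Rightarrow> ('l, 'r) mat \<Rightarrow> ('l, 'r) mat" where
  "mat_mult x y = (\<lambda>a c. Sum_any (\<lambda>b. x a b * y b c))"

text \<open>\<open>mat_e r a b\<close> is \<open>r e\<^sub>a\<^sub>b\<close>.\<close>

definition mat_e :: "'r::ring_1 \<Rightarrow> 'l \<Rightarrow> 'l \<Rightarrow> ('l, 'r) mat" where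
  "mat_e r a b = (\<lambda>c d. if c = a \<and> d = b then r else 0)"

lemma mat_e_mult_same: "mat_mult (mat_e r a b) (mat_e s b c) = mat_e (r * s) a c"
proof (intro ext)
  fix x z
  show "mat_mult (mat_e r a b) (mat_e s b c) x z = mat_e (r * s) a c x z"
    unfolding mat_mult_def
    by (subst Sum_any.expand_superset[of "{b}"]) (auto simp: mat_e_def split: if_splits)
qed

lemma mat_e_mult_diff: "b \<noteq> c \<Longrightarrow> mat_mult (mat_e r a b) (mat_e s c d) = (\<lambda>_ _. 0)"
  unfolding mat_mult_def mat_e_def
  by (intro ext, subst Sum_any.expand_superset[of "{}"]) (auto split: if_splits)

definition mclain :: "('l::order, 'r::ring_1) mat monoid" where
  "mclain = \<lparr>carrier = {mat_add mat_one x |x. x \<in> mclain_J}, mult = mat_mult, one = mat_one\<rparr>"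

definition root_subgroup :: "'l::order \<Rightarrow> 'l \<Rightarrow> ('l, 'r::ring_1) mat set" where
  "root_subgroup a b = {mat_add mat_one (mat_e r a b) |r. True}"

text \<open>\<open>M(\<Delta>)\<close>; it is used below only for the closed subsets \<open>col_roots\<close> and \<open>row_roots\<close> of \<open>Phi\<close>.\<close>

definition mclain_sub :: "('l::order \<times> 'l) set \<Rightarrow> ('l, 'r::ring_1) mat set" where
  "mclain_sub \<Delta> = generate mclain (\<Union>(a, b)\<in>\<Delta>. root_subgroup a b)"

text \<open>\<open>[a, \<down>, b]\<close> and \<open>[a, \<rightarrow>, b]\<close>.\<close>

definition col_roots :: "'l::order \<Rightarrow> 'l \<Rightarrow> ('l \<times> 'l) set" where
  "col_roots a b = {(c, b) |c. a \<le> c \<and> c < b}"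

definition row_roots :: "'l::order \<Rightarrow> 'l \<Rightarrow> ('l \<times> 'l) set" where
  "row_roots a b = {(a, c) |c. a < c \<and> c \<le> b}"

abbreviation subgrp :: "('l::order, 'r::ring_1) mat set \<Rightarrow> ('l, 'r) mat monoid" where
  "subgrp H \<equiv> mclain\<lparr>carrier := H\<rparr>"

text \<open>\<open>M\<close> with upper index \<open>ab\<close>.\<close>

definition mclain_ab :: "'l::order \<Rightarrow> 'l \<Rightarrow> ('l, 'r::ring_1) mat monoid" where
  "mclain_ab a b = subgrp (mclain_sub (col_roots a b) <#>\<^bsub>mclain\<^esub> mclain_sub (row_roots a b))"


section \<open>Right primitive linear characters\<close>

definition linear_character :: "('r::ring_1 \<Rightarrow> 'f::field) \<Rightarrow> bool" where
  "linear_character lam \<longleftrightarrow> (\<forall>x. lam x \<noteq> 0) \<and> (\<forall>x y. lam (x + y) = lam x * lam y)"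

definition right_ideal :: "'r::ring_1 set \<Rightarrow> bool" where
  "right_ideal I \<longleftrightarrow> 0 \<in> I \<and> (\<forall>x\<in>I. \<forall>y\<in>I. x - y \<in> I) \<and> (\<forall>x\<in>I. \<forall>r. x * r \<in> I)"

definition right_primitive :: "('r::ring_1 \<Rightarrow> 'f::field) \<Rightarrow> bool" where
  "right_primitive lam \<longleftrightarrow> linear_character lam \<and>
    (\<forall>I. right_ideal I \<and> I \<subseteq> {x. lam x = 1} \<longrightarrow> I = {0})"


section \<open>Modules for a group over a field\<close>

text \<open>
  The underlying space of a module is a subspace \<open>space V\<close> of a vector space \<open>(scale, 'v)\<close>;
  only the values of \<open>act V\<close> on \<open>carrier G\<close> and \<open>space V\<close> are relevant.
  The restriction of a \<open>G\<close>-module \<open>V\<close> to a subgroup is \<open>V\<close> itself, regarded as a module for the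
  subgroup.
\<close>

record ('g, 'v) rep =
  space :: "'v set"
  act :: "'g \<Rightarrow> 'v \<Rightarrow> 'v"

definition group_module ::
  "('f::field \<Rightarrow> 'v::ab_group_add \<Rightarrow> 'v) \<Rightarrow> 'g monoid \<Rightarrow> ('g, 'v) rep \<Rightarrow> bool" where
  "group_module scale G V \<longleftrightarrow>
     vector_space scale \<and> group G \<and> module.subspace scale (space V) \<and>
     (\<forall>g\<in>carrier G. \<forall>v\<in>space V. act V g v \<in> space V) \<and>
     (\<forall>g\<in>carrier G. \<forall>v\<in>space V. \<forall>w\<in>space V. act V g (v + w) = act V g v + act V g w) \<and>
     (\<forall>g\<in>carrier G. \<forall>c. \<forall>v\<in>space V. act V g (scale c v) = scale c (act V g v)) \<and>
     (\<forall>v\<in>space V. act V \<one>\<^bsub>G\<^esub> v = v) \<and>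
     (\<forall>g\<in>carrier G. \<forall>h\<in>carrier G. \<forall>v\<in>space V. act V (g \<otimes>\<^bsub>G\<^esub> h) v = act V g (act V h v))"

definition gsubmodule ::
  "('f::field \<Rightarrow> 'v::ab_group_add \<Rightarrow> 'v) \<Rightarrow> 'g monoid \<Rightarrow> ('g, 'v) rep \<Rightarrow> 'v set \<Rightarrow> bool" where
  "gsubmodule scale G V W \<longleftrightarrow>
     module.subspace scale W \<and> W \<subseteq> space V \<and> (\<forall>g\<in>carrier G. \<forall>w\<in>W. act V g w \<in> W)"

definition irreducible_gsubmodule ::
  "('f::field \<Rightarrow> 'v::ab_group_add \<Rightarrow> 'v) \<Rightarrow> 'g monoid \<Rightarrow> ('g, 'v) rep \<Rightarrow> 'v set \<Rightarrow> bool" where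
  "irreducible_gsubmodule scale G V W \<longleftrightarrow>
     gsubmodule scale G V W \<and> W \<noteq> {0} \<and>
     (\<forall>U. gsubmodule scale G V U \<and> U \<subseteq> W \<longrightarrow> U = {0} \<or> U = W)"

definition irreducible_gmodule ::
  "('f::field \<Rightarrow> 'v::ab_group_add \<Rightarrow> 'v) \<Rightarrow> 'g monoid \<Rightarrow> ('g, 'v) rep \<Rightarrow> bool" where
  "irreducible_gmodule scale G V \<longleftrightarrow>
     group_module scale G V \<and> irreducible_gsubmodule scale G V (space V)"

text \<open>The second and third conjunct say that \<open>space V\<close> is the internal direct sum of \<open>\<W>\<close>.\<close>

definition completely_reducible ::
  "('f::field \<Rightarrow> 'v::ab_group_add \<Rightarrow> 'v) \<Rightarrow> 'g monoid \<Rightarrow> ('g, 'v) rep \<Rightarrow> bool" where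
  "completely_reducible scale G V \<longleftrightarrow>
     (\<exists>\<W>. (\<forall>W\<in>\<W>. irreducible_gsubmodule scale G V W) \<and>
          module.span scale (\<Union>\<W>) = space V \<and>
          (\<forall>W\<in>\<W>. W \<inter> module.span scale (\<Union>(\<W> - {W})) = {0}))"

definition gmodule_iso ::
  "('f::field \<Rightarrow> 'v::ab_group_add \<Rightarrow> 'v) \<Rightarrow> 'g monoid \<Rightarrow> ('g, 'v) rep \<Rightarrow> ('g, 'v) rep \<Rightarrow> bool" where
  "gmodule_iso scale G V W \<longleftrightarrow>
     (\<exists>f. bij_betw f (space V) (space W) \<and>
          (\<forall>v\<in>space V. \<forall>w\<in>space V. f (v + w) = f v + f w) \<and>
          (\<forall>c. \<forall>v\<in>space V. f (scale c v) = scale c (f v)) \<and>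
          (\<forall>g\<in>carrier G. \<forall>v\<in>space V. f (act V g v) = act W g (f v)))"

definition lies_over ::
  "('f::field \<Rightarrow> 'v::ab_group_add \<Rightarrow> 'v) \<Rightarrow> 'l::order \<Rightarrow> 'l \<Rightarrow> ('r::ring_1 \<Rightarrow> 'f)
    \<Rightarrow> (('l, 'r) mat, 'v) rep \<Rightarrow> bool" where
  "lies_over scale a b lam V \<longleftrightarrow>
     (\<exists>W. gsubmodule scale (subgrp (root_subgroup a b)) V W \<and> vector_space.dim scale W = 1 \<and>
          (\<forall>r. \<forall>w\<in>W. act V (mat_add mat_one (mat_e r a b)) w = scale (lam r) w))"

text \<open>
  The \<open>'f\<close>-vector space \<open>'x \<Rightarrow>\<^sub>0 'f\<close> with basis \<open>'x\<close>.  For \<open>'x = ('l, 'r) mat\<close> it contains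
  the underlying space of the group algebra of \<open>M\<close>, of which any irreducible module for a subgroup of
  \<open>M\<close> is, as a vector space, a quotient; so every irreducible module is isomorphic to one
  whose underlying space is a subspace of it.
\<close>

definition fscale :: "'f::field \<Rightarrow> ('x \<Rightarrow>\<^sub>0 'f) \<Rightarrow> ('x \<Rightarrow>\<^sub>0 'f)" where
  "fscale c p = Poly_Mapping.map ((*) c) p"

lemma lookup_fscale: "poly_mapping.lookup (fscale c p) x = c * poly_mapping.lookup p x"
  by (simp add: fscale_def map.rep_eq when_def)

lemma vector_space_fscale: "vector_space (fscale :: 'f::field \<Rightarrow> ('x \<Rightarrow>\<^sub>0 'f) \<Rightarrow> _)"
  by unfold_locales
     (auto intro!: poly_mapping_eqI simp: lookup_fscale lookup_add algebra_simps)

end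

theory Submission
  imports Defs "HOL-Library.Function_Algebras"
begin

text \<open>
  Write \<open>I\<close> for the open interval from \<open>\<alpha>\<close> to \<open>\<beta>\<close>. The group \<open>M\<close> with upper index
  \<open>\<alpha>\<beta>\<close> is a Heisenberg group: its elements are triples \<open>(v, u, z)\<close> of a finitely supported row
  vector \<open>v\<close> and column vector \<open>u\<close> over \<open>I\<close> and a central \<open>z\<close> in \<open>R\<close>, with
  cocycle the product \<open>v u\<close>. Any function \<open>f\<close> from \<open>I\<close> to \<open>R\<close> gives a
  character \<open>(0, u, z) \<mapsto> \<lambda>(z + f u)\<close> of the column group; inducing it gives a module whose
  basis is the set of row vectors, on which the row group acts through translations and the column group by
  the characters belonging to \<open>f - y\<close>. Right primitivity makes these characters distinct, so the
  module is irreducible and two modules are isomorphic only if their functions differ at finitely many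
  points; as \<open>I\<close> is infinite there are uncountably many classes. Over the row group the module is,
  up to \<open>\<lambda>\<close> on the centre, the group algebra of a direct sum of infinitely many nontrivial groups,
  which has no minimal ideal: given \<open>p \<noteq> 0\<close>, choose a coordinate outside its support; then
  \<open>(t - 1) p\<close>, with \<open>t\<close> a translation in that coordinate, generates a proper nonzero submodule.
\<close>

section \<open>Unitriangular matrices with prescribed support\<close>

definition offdiag_supp :: "('l, 'r::ring_1) mat \<Rightarrow> ('l \<times> 'l) set" where
  "offdiag_supp g = {(a, b). a \<noteq> b \<and> g a b \<noteq> 0}"

text \<open>An entrywise description of elements \<open>1 + x\<close>, so that membership can be
  checked on single entries. The comparison with the carrier of \<open>mclain\<close> and with
  generated subgroups is made in \<open>carrier_mclain\<close> and
  \<open>mclain_sub_noncomposable\<close>.\<close>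

definition unitri :: "('l::order \<times> 'l) set \<Rightarrow> ('l, 'r::ring_1) mat set" where
  "unitri \<Delta> = {g. (\<forall>a. g a a = 1) \<and> finite (offdiag_supp g) \<and> offdiag_supp g \<subseteq> \<Delta>}"

lemma unitri_diag: "g \<in> unitri \<Delta> \<Longrightarrow> g a a = 1"
  by (simp add: unitri_def)

lemma unitri_offdiag: "g \<in> unitri \<Delta> \<Longrightarrow> a \<noteq> b \<Longrightarrow> (a, b) \<notin> \<Delta> \<Longrightarrow> g a b = 0"
  by (auto simp: unitri_def offdiag_supp_def)

lemma unitri_mono: "\<Delta> \<subseteq> \<Delta>' \<Longrightarrow> unitri \<Delta> \<subseteq> unitri \<Delta>'"
  by (auto simp: unitri_def)

lemma mat_one_in_unitri: "mat_one \<in> unitri \<Delta>"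
  by (auto simp: unitri_def offdiag_supp_def mat_one_def)

lemma finite_row:
  assumes "g \<in> unitri \<Delta>"
  shows "finite {b. g a b \<noteq> 0}"
proof (rule finite_subset)
  show "{b. g a b \<noteq> 0} \<subseteq> insert a (snd ` offdiag_supp g)"
    by (force simp: offdiag_supp_def image_iff)
  show "finite (insert a (snd ` offdiag_supp g))"
    using assms by (simp add: unitri_def)
qed

lemma finite_column:
  assumes "g \<in> unitri \<Delta>"
  shows "finite {a. g a b \<noteq> 0}"
proof (rule finite_subset)
  show "{a. g a b \<noteq> 0} \<subseteq> insert b (fst ` offdiag_supp g)"
    by (force simp: offdiag_supp_def image_iff)
  show "finite (insert b (fst ` offdiag_supp g))"
    using assms by (simp add: unitri_def)
qed

section \<open>Products of matrices with finite rows\<close>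

lemma mat_mult_eq_sum:
  assumes "finite S" "{b. x a b \<noteq> 0} \<subseteq> S"
  shows "mat_mult x y a c = (\<Sum>b\<in>S. x a b * y b c)"
  unfolding mat_mult_def using assms by (intro Sum_any.expand_superset) auto

lemma mat_mult_nonzeroE:
  assumes "mat_mult x y a c \<noteq> 0"
  obtains b where "x a b \<noteq> 0" "y b c \<noteq> 0"
proof -
  from assms obtain b where "x a b * y b c \<noteq> 0"
    unfolding mat_mult_def by (rule Sum_any.not_neutral_obtains_not_neutral)
  then show ?thesis
    by (intro that[of b]) auto
qed

text \<open>Finite rows of \<open>x\<close> and \<open>y\<close> allow both sides to be written as a
  double sum over one finite rectangle \<open>S\<close> times \<open>T\<close>, where the order of
  summation can be exchanged.\<close>

lemma mat_mult_assoc: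
  assumes x: "\<And>a. finite {b. x a b \<noteq> 0}" and y: "\<And>a. finite {b. y a b \<noteq> 0}"
  shows "mat_mult (mat_mult x y) z = mat_mult x (mat_mult y z)"
proof (intro ext)
  fix a d
  define S where "S = {b. x a b \<noteq> 0}"
  define T where "T = (\<Union>b\<in>S. {c. y b c \<noteq> 0})"
  have S: "finite S" and T: "finite T"
    using x y by (auto simp: S_def T_def)
  have "{c. mat_mult x y a c \<noteq> 0} \<subseteq> T"
    by (auto simp: T_def S_def elim!: mat_mult_nonzeroE)
  then have "mat_mult (mat_mult x y) z a d = (\<Sum>c\<in>T. mat_mult x y a c * z c d)"
    using T by (intro mat_mult_eq_sum)
  also have "\<dots> = (\<Sum>c\<in>T. \<Sum>b\<in>S. x a b * y b c * z c d)"
    using S by (simp add: mat_mult_eq_sum[of S] S_def sum_distrib_right)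
  also have "\<dots> = (\<Sum>b\<in>S. \<Sum>c\<in>T. x a b * (y b c * z c d))"
    by (subst sum.swap) (simp add: mult.assoc)
  also have "\<dots> = (\<Sum>b\<in>S. x a b * mat_mult y z b d)"
  proof (rule sum.cong[OF refl])
    fix b assume "b \<in> S"
    then have "{c. y b c \<noteq> 0} \<subseteq> T" by (auto simp: T_def)
    then show "(\<Sum>c\<in>T. x a b * (y b c * z c d)) = x a b * mat_mult y z b d"
      using T by (simp add: mat_mult_eq_sum sum_distrib_left)
  qed
  also have "\<dots> = mat_mult x (mat_mult y z) a d"
    using S by (simp add: mat_mult_eq_sum S_def)
  finally show "mat_mult (mat_mult x y) z a d = mat_mult x (mat_mult y z) a d" .
qed

lemma mat_mult_one_left: "mat_mult mat_one x = x"
  by (intro ext) (simp add: mat_mult_eq_sum[of "{_}"] mat_one_def)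

lemma mat_mult_one_right: "mat_mult x mat_one = x"
proof (intro ext)
  fix a c
  show "mat_mult x mat_one a c = x a c"
    unfolding mat_mult_def mat_one_def
    by (subst Sum_any.expand_superset[of "{c}"]) auto
qed

text \<open>Because the diagonals are 1, the terms \<open>b = a\<close> and \<open>b = c\<close>
  contribute \<open>h a c\<close> and \<open>g a c\<close>. What remains is the sum over genuine
  intermediate indices.\<close>

lemma mat_mult_offdiag:
  assumes g: "g \<in> unitri \<Delta>" and h: "h \<in> unitri \<Delta>'" and "a \<noteq> c"
  shows "mat_mult g h a c =
    g a c + h a c + Sum_any (\<lambda>b. if b \<noteq> a \<and> b \<noteq> c then g a b * h b c else 0)"
proof -
  let ?r = "\<lambda>b. if b \<noteq> a \<and> b \<noteq> c then g a b * h b c else 0"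
  have fin: "finite {b. ?r b \<noteq> 0}"
    by (rule finite_subset[OF _ finite_row[OF g, of a]]) auto
  let ?p = "\<lambda>b. if b = c then g a c else 0" and ?q = "\<lambda>b. if b = a then h a c else 0"
  have p: "finite {b. ?p b \<noteq> 0}" and q: "finite {b. ?q b \<noteq> 0}"
    by (auto intro: rev_finite_subset[of "{c}"] rev_finite_subset[of "{a}"])
  have pq: "finite {b. ?p b + ?q b \<noteq> 0}"
    by (rule finite_subset[of _ "{a, c}"]) auto
  have "mat_mult g h a c = Sum_any (\<lambda>b. (?p b + ?q b) + ?r b)"
    unfolding mat_mult_def using assms
    by (intro Sum_any.cong) (auto simp: unitri_diag)
  also have "\<dots> = Sum_any ?p + Sum_any ?q + Sum_any ?r"
    by (simp only: Sum_any.distrib[OF pq fin] Sum_any.distrib[OF p q])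
  finally show ?thesis
    by simp
qed

text \<open>An index \<open>b \<noteq> a\<close> could contribute only if both \<open>a < b\<close>
  and \<open>b < a\<close>.\<close>

lemma mat_mult_diag:
  assumes "\<Delta> \<subseteq> Phi" "\<Delta>' \<subseteq> Phi" "g \<in> unitri \<Delta>" "h \<in> unitri \<Delta>'"
  shows "mat_mult g h a a = 1"
proof -
  have "g a b * h b a = 0" if "b \<noteq> a" for b
  proof -
    have "(a, b) \<notin> \<Delta> \<or> (b, a) \<notin> \<Delta>'"
      using assms(1,2) less_asym[of a b] by (auto simp: Phi_def subset_iff)
    then have "g a b = 0 \<or> h b a = 0"
      using assms that by (metis unitri_offdiag)
    then show ?thesis by auto
  qed
  then have "mat_mult g h a a = Sum_any (\<lambda>b. if b = a then g a a * h a a else 0)"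
    unfolding mat_mult_def by (intro Sum_any.cong) auto
  then show ?thesis
    using assms by (simp add: unitri_diag)
qed

lemma mat_mult_in_unitri:
  assumes "\<Delta> \<subseteq> Phi" and g: "g \<in> unitri \<Delta>" and h: "h \<in> unitri \<Delta>"
    and closed: "\<And>a b c. (a, b) \<in> \<Delta> \<Longrightarrow> (b, c) \<in> \<Delta> \<Longrightarrow> (a, c) \<in> \<Delta>"
  shows "mat_mult g h \<in> unitri \<Delta>"
proof -
  let ?G = "offdiag_supp g" and ?H = "offdiag_supp h"
  \<comment> \<open>A nonzero entry of the product comes from one factor or from a composable pair
    of entries. Intersecting with \<open>\<Delta>\<close> lets this single inclusion yield both
    finiteness and the bound on the support.\<close>
  have sub: "offdiag_supp (mat_mult g h) \<subseteq> ?G \<union> ?H \<union> ((\<lambda>(p, q). (fst p, snd q)) ` (?G \<times> ?H) \<inter> \<Delta>)"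
  proof
    fix p assume "p \<in> offdiag_supp (mat_mult g h)"
    then obtain a c where p: "p = (a, c)" "a \<noteq> c" "mat_mult g h a c \<noteq> 0"
      by (auto simp: offdiag_supp_def)
    then obtain b where b: "g a b \<noteq> 0" "h b c \<noteq> 0"
      by (auto elim: mat_mult_nonzeroE)
    show "p \<in> ?G \<union> ?H \<union> ((\<lambda>(p, q). (fst p, snd q)) ` (?G \<times> ?H) \<inter> \<Delta>)"
    proof (cases "b = a \<or> b = c")
      case True
      then show ?thesis using p b by (auto simp: offdiag_supp_def)
    next
      case False
      then have *: "(a, b) \<in> ?G" "(b, c) \<in> ?H"
        using b by (auto simp: offdiag_supp_def)
      then have "(a, c) \<in> \<Delta>"
        using g h by (intro closed[of a b c]) (auto simp: unitri_def)
      moreover have "(a, c) \<in> (\<lambda>(p, q). (fst p, snd q)) ` (?G \<times> ?H)"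
        using * by (intro image_eqI[of _ _ "((a, b), (b, c))"]) auto
      ultimately show ?thesis using p by auto
    qed
  qed
  have "finite ?G" "finite ?H" "?G \<subseteq> \<Delta>" "?H \<subseteq> \<Delta>"
    using g h by (auto simp: unitri_def)
  then have "finite (offdiag_supp (mat_mult g h))" "offdiag_supp (mat_mult g h) \<subseteq> \<Delta>"
    using sub by (auto elim!: finite_subset)
  then show ?thesis
    using mat_mult_diag[OF assms(1,1) g h] by (simp add: unitri_def)
qed

section \<open>The McLain group as a monoid of unitriangular matrices\<close>

lemma carrier_mclain: "carrier mclain = unitri Phi"
proof (intro equalityI subsetI)
  fix g :: "('a, 'b) mat" assume "g \<in> carrier mclain"
  then obtain x where x: "g = mat_add mat_one x" "x \<in> mclain_J"
    by (auto simp: mclain_def)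
  then have "x a a = 0" for a
    by (auto simp: mclain_J_def Phi_def)
  moreover have "offdiag_supp g \<subseteq> {(a, b). x a b \<noteq> 0}"
    using x by (auto simp: offdiag_supp_def mat_add_def mat_one_def)
  ultimately show "g \<in> unitri Phi"
    using x by (auto simp: unitri_def mclain_J_def mat_add_def mat_one_def elim: finite_subset)
next
  fix g :: "('a, 'b) mat" assume g: "g \<in> unitri Phi"
  let ?x = "\<lambda>a b. if a = b then 0 else g a b"
  have "{(a, b). ?x a b \<noteq> 0} = offdiag_supp g"
    by (auto simp: offdiag_supp_def)
  then have "?x \<in> mclain_J" "g = mat_add mat_one ?x"
    using g by (auto simp: unitri_def mclain_J_def mat_add_def mat_one_def fun_eq_iff)
  then show "g \<in> carrier mclain"
    unfolding mclain_def by auto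
qed

lemma mult_mclain: "mult mclain = mat_mult" and one_mclain: "\<one>\<^bsub>mclain\<^esub> = mat_one"
  by (simp_all add: mclain_def)

lemma monoid_mclain: "Group.monoid (mclain :: ('l::order, 'r::ring_1) mat monoid)"
proof (rule Group.monoidI; unfold carrier_mclain mult_mclain one_mclain)
  fix x y z :: "('l, 'r) mat"
  assume "x \<in> unitri Phi" "y \<in> unitri Phi"
  then show "mat_mult x y \<in> unitri Phi"
    by (intro mat_mult_in_unitri) (auto simp: Phi_def)
  show "mat_mult (mat_mult x y) z = mat_mult x (mat_mult y z)"
    by (intro mat_mult_assoc finite_row) fact+
qed (simp_all add: mat_one_in_unitri mat_mult_one_left mat_mult_one_right)

section \<open>Subgroups generated by non-composable roots\<close>

text \<open>Any two basis vectors with roots in such a set have product 0, so off-diagonal entries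
  simply add under multiplication. The column roots and the row roots are both of this kind.\<close>

definition noncomposable :: "('l \<times> 'l) set \<Rightarrow> bool" where
  "noncomposable \<Delta> \<longleftrightarrow> (\<forall>a b c. (a, b) \<in> \<Delta> \<longrightarrow> (b, c) \<notin> \<Delta>)"

lemma mat_mult_noncomposable:
  assumes "noncomposable \<Delta>" "g \<in> unitri \<Delta>" "h \<in> unitri \<Delta>" "a \<noteq> c"
  shows "mat_mult g h a c = g a c + h a c"
proof -
  have "g a b * h b c = 0" if "b \<noteq> a" "b \<noteq> c" for b
  proof -
    have "(a, b) \<notin> \<Delta> \<or> (b, c) \<notin> \<Delta>"
      using assms by (auto simp: noncomposable_def)
    then have "g a b = 0 \<or> h b c = 0"
      using assms that by (metis unitri_offdiag)
    then show ?thesis by auto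
  qed
  then have "Sum_any (\<lambda>b. if b \<noteq> a \<and> b \<noteq> c then g a b * h b c else 0) = 0"
    by (subst Sum_any.expand_superset[of "{}"]) auto
  then show ?thesis
    using mat_mult_offdiag[OF assms(2-4)] by simp
qed

lemma elementary_in_unitri: "a < b \<Longrightarrow> (a, b) \<in> \<Delta> \<Longrightarrow> mat_add mat_one (mat_e r a b) \<in> unitri \<Delta>"
  by (auto simp: unitri_def offdiag_supp_def mat_add_def mat_one_def mat_e_def
      intro: finite_subset[of _ "{(a, b)}"] split: if_splits)

text \<open>A single root is noncomposable, so the entries \<open>r\<close> and \<open>- r\<close>
  add up to 0. Since \<open>mclain\<close> is known here only as a monoid, the inverse is identified
  through its uniqueness.\<close>

lemma inv_elementary:
  fixes a b :: "'l::order" and r :: "'r::ring_1"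
  assumes "a < b"
  shows "inv\<^bsub>mclain\<^esub> (mat_add mat_one (mat_e r a b)) = mat_add mat_one (mat_e (- r) a b)"
proof -
  interpret Group.monoid "mclain :: ('l, 'r) mat monoid" by (rule monoid_mclain)
  have el: "mat_add mat_one (mat_e s a b) \<in> unitri {(a, b)}" for s :: 'r
    using assms by (simp add: elementary_in_unitri)
  have nc: "noncomposable {(a, b)}" and Phi: "{(a, b)} \<subseteq> Phi"
    using assms by (auto simp: noncomposable_def Phi_def)
  have *: "mat_mult (mat_add mat_one (mat_e s a b)) (mat_add mat_one (mat_e (- s) a b)) = mat_one"
    for s :: 'r
  proof (intro ext)
    fix c d
    show "mat_mult (mat_add mat_one (mat_e s a b)) (mat_add mat_one (mat_e (- s) a b)) c d
        = mat_one c d"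
    proof (cases "c = d")
      case True
      then show ?thesis using mat_mult_diag[OF Phi Phi el el] by (simp add: mat_one_def)
    next
      case False
      then show ?thesis using mat_mult_noncomposable[OF nc el el False]
        by (simp add: mat_one_def mat_add_def mat_e_def)
    qed
  qed
  have carr: "mat_add mat_one (mat_e s a b) \<in> carrier mclain" for s :: 'r
    using el unitri_mono[OF Phi] by (auto simp: carrier_mclain)
  show ?thesis
    unfolding m_inv_def
  proof (rule the_equality)
    show "mat_add mat_one (mat_e (- r) a b) \<in> carrier mclain \<and>
        mat_add mat_one (mat_e r a b) \<otimes>\<^bsub>mclain\<^esub> mat_add mat_one (mat_e (- r) a b) = \<one>\<^bsub>mclain\<^esub> \<and>
        mat_add mat_one (mat_e (- r) a b) \<otimes>\<^bsub>mclain\<^esub> mat_add mat_one (mat_e r a b) = \<one>\<^bsub>mclain\<^esub>"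
      using carr *[of r] *[of "- r"] by (simp add: mult_mclain one_mclain)
    then show "y = mat_add mat_one (mat_e (- r) a b)"
      if "y \<in> carrier mclain \<and>
        mat_add mat_one (mat_e r a b) \<otimes>\<^bsub>mclain\<^esub> y = \<one>\<^bsub>mclain\<^esub> \<and>
        y \<otimes>\<^bsub>mclain\<^esub> mat_add mat_one (mat_e r a b) = \<one>\<^bsub>mclain\<^esub>" for y
      using that carr[of r] by (blast intro: inv_unique)
  qed
qed

lemma mclain_sub_subset:
  assumes "\<Delta> \<subseteq> Phi" "\<And>a b c. (a, b) \<in> \<Delta> \<Longrightarrow> (b, c) \<in> \<Delta> \<Longrightarrow> (a, c) \<in> \<Delta>"
  shows "mclain_sub \<Delta> \<subseteq> unitri \<Delta>"
proof
  fix g :: "('a, 'b) mat" assume "g \<in> mclain_sub \<Delta>"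
  then show "g \<in> unitri \<Delta>"
    unfolding mclain_sub_def
  proof induction
    case one
    then show ?case by (simp add: one_mclain mat_one_in_unitri)
  next
    case (incl h)
    then show ?case using assms(1) by (auto simp: root_subgroup_def Phi_def intro!: elementary_in_unitri)
  next
    case (inv h)
    then obtain a b r where "(a, b) \<in> \<Delta>" "h = mat_add mat_one (mat_e r a b)"
      by (auto simp: root_subgroup_def)
    moreover from this have "a < b"
      using assms(1) by (auto simp: Phi_def)
    ultimately show ?case
      by (simp add: inv_elementary elementary_in_unitri)
  next
    case (eng g h)
    show ?case unfolding mult_mclain
      by (rule mat_mult_in_unitri[OF assms(1) eng.IH]) (rule assms(2))
  qed
qed

text \<open>Since entries add, a matrix is the product of the elementary matrices of its finitely
  many nonzero off-diagonal entries; the induction splits these off one at a time.\<close>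

lemma mclain_sub_noncomposable:
  assumes Phi: "\<Delta> \<subseteq> Phi" and nc: "noncomposable \<Delta>"
  shows "mclain_sub \<Delta> = unitri \<Delta>"
proof
  show "mclain_sub \<Delta> \<subseteq> unitri \<Delta>"
    using nc by (intro mclain_sub_subset[OF Phi]) (auto simp: noncomposable_def)
  have "g \<in> unitri \<Delta> \<Longrightarrow> offdiag_supp g \<subseteq> S \<Longrightarrow> g \<in> mclain_sub \<Delta>" if "finite S" for S and g :: "('a, 'b) mat"
    using that
  proof (induction S arbitrary: g rule: finite_induct)
    case empty
    then have "g = mat_one"
      by (auto simp: unitri_def offdiag_supp_def mat_one_def fun_eq_iff)
    then show ?case
      using generate.one[of mclain] by (simp add: mclain_sub_def one_mclain)
  next
    case (insert p S)
    obtain a b where p: "p = (a, b)" by force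
    show ?case
    proof (cases "p \<in> offdiag_supp g")
      case False
      then show ?thesis using insert by blast
    next
      case True
      then have ab: "(a, b) \<in> \<Delta>" "a < b" "a \<noteq> b"
        using insert.prems p Phi by (auto simp: unitri_def Phi_def)
      let ?e = "mat_add mat_one (mat_e (g a b) a b)"
      \<comment> \<open>\<open>?h\<close> is \<open>g\<close> with the entry at
        \<open>(a, b)\<close> erased, so that additivity gives back \<open>g\<close> as the product
        of \<open>?h\<close> and \<open>?e\<close>.\<close>
      let ?h = "\<lambda>c d. if (c, d) = (a, b) then 0 else g c d"
      have e: "?e \<in> unitri \<Delta>"
        using ab by (simp add: elementary_in_unitri)
      have supp: "offdiag_supp ?h = offdiag_supp g - {(a, b)}"
        by (auto simp: offdiag_supp_def)
      have h: "?h \<in> unitri \<Delta>"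
        using insert.prems ab unfolding unitri_def mem_Collect_eq supp by auto
      have "?h \<in> mclain_sub \<Delta>"
        using insert.prems p by (intro insert.IH h, subst supp) auto
      moreover have "?e \<in> mclain_sub \<Delta>"
        using ab unfolding mclain_sub_def by (intro generate.incl UN_I[of "(a, b)"]) (auto simp: root_subgroup_def)
      ultimately have "mat_mult ?h ?e \<in> mclain_sub \<Delta>"
        unfolding mclain_sub_def mult_mclain[symmetric] by (rule generate.eng)
      moreover have "mat_mult ?h ?e = g"
      proof (intro ext)
        fix c d
        show "mat_mult ?h ?e c d = g c d"
        proof (cases "c = d")
          case True
          then show ?thesis
            using mat_mult_diag[OF Phi Phi h e] insert.prems by (simp add: unitri_diag)
        next
          case False
          then show ?thesis
            using mat_mult_noncomposable[OF nc h e False] by (auto simp: mat_add_def mat_one_def mat_e_def)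
        qed
      qed
      ultimately show ?thesis by simp
    qed
  qed
  then show "(unitri \<Delta> :: ('a, 'b) mat set) \<subseteq> mclain_sub \<Delta>"
    by (auto simp: unitri_def)
qed

section \<open>The group of a root as a Heisenberg group\<close>

locale mclain_root =
  fixes \<alpha> \<beta> :: "'l::order"
  assumes less: "\<alpha> < \<beta>"
begin

abbreviation col :: "('l \<times> 'l) set" where "col \<equiv> col_roots \<alpha> \<beta>"
abbreviation row :: "('l \<times> 'l) set" where "row \<equiv> row_roots \<alpha> \<beta>"

definition inner :: "'l \<Rightarrow> bool" where
  "inner c \<longleftrightarrow> \<alpha> < c \<and> c < \<beta>"

text \<open>The Heisenberg cocycle: a row vector times the \<open>\<beta>\<close> column of
  \<open>g\<close>. The row vector is an arbitrary function because it will also be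
  \<open>f - y\<close>, whose support may be infinite; finiteness comes from the column of
  \<open>g\<close>.\<close>

definition dot :: "('l \<Rightarrow> 'r::ring_1) \<Rightarrow> ('l, 'r) mat \<Rightarrow> 'r" where
  "dot v g = Sum_any (\<lambda>c. if inner c then v c * g c \<beta> else 0)"

lemma inner_neq: "inner c \<Longrightarrow> c \<noteq> \<alpha>" "inner c \<Longrightarrow> c \<noteq> \<beta>"
  by (auto simp: inner_def)

lemma not_inner [simp]: "\<not> inner \<alpha>" "\<not> inner \<beta>"
  by (auto simp: inner_def)

lemma in_roots_iff: "(a, b) \<in> col \<union> row \<longleftrightarrow> (a = \<alpha> \<and> b = \<beta>) \<or> (inner a \<and> b = \<beta>) \<or> (a = \<alpha> \<and> inner b)"
  using less by (auto simp: col_roots_def row_roots_def inner_def le_less)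

lemma in_col_iff: "(a, b) \<in> col \<longleftrightarrow> (a = \<alpha> \<and> b = \<beta>) \<or> (inner a \<and> b = \<beta>)"
  using less by (auto simp: col_roots_def inner_def le_less)

lemma in_row_iff: "(a, b) \<in> row \<longleftrightarrow> (a = \<alpha> \<and> b = \<beta>) \<or> (a = \<alpha> \<and> inner b)"
  using less by (auto simp: row_roots_def inner_def le_less)

lemma roots_subset_Phi: "col \<union> row \<subseteq> Phi"
  using less by (auto simp: Phi_def in_col_iff in_row_iff inner_def)

lemma finite_dot:
  assumes "g \<in> unitri \<Delta>"
  shows "finite {c. (if inner c then v c * g c \<beta> else 0) \<noteq> 0}"
  by (rule finite_subset[OF _ finite_column[OF assms, of \<beta>]]) auto

lemma dot_add_left:
  assumes "g \<in> unitri \<Delta>"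
  shows "dot (\<lambda>c. v c + w c) g = dot v g + dot w g"
  unfolding dot_def
  by (subst Sum_any.distrib[symmetric, OF finite_dot[OF assms] finite_dot[OF assms]])
    (auto intro!: Sum_any.cong simp: distrib_right)

lemma dot_add_right:
  assumes "g \<in> unitri \<Delta>" "h \<in> unitri \<Delta>'" "\<And>c. inner c \<Longrightarrow> k c \<beta> = g c \<beta> + h c \<beta>"
  shows "dot v k = dot v g + dot v h"
  unfolding dot_def
  by (subst Sum_any.distrib[symmetric, OF finite_dot[OF assms(1)] finite_dot[OF assms(2)]])
    (auto intro!: Sum_any.cong simp: distrib_left assms(3))

lemma dot_zero_left: "(\<And>c. inner c \<Longrightarrow> v c = 0) \<Longrightarrow> dot v g = 0"
  unfolding dot_def by (subst Sum_any.expand_superset[of "{}"]) auto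

lemma dot_zero_right: "(\<And>c. inner c \<Longrightarrow> g c \<beta> = 0) \<Longrightarrow> dot v g = 0"
  unfolding dot_def by (subst Sum_any.expand_superset[of "{}"]) auto

lemma dot_elementary:
  assumes "inner c"
  shows "dot v (mat_add mat_one (mat_e r c \<beta>)) = v c * r"
proof -
  have "dot v (mat_add mat_one (mat_e r c \<beta>)) = Sum_any (\<lambda>d. if d = c then v c * r else 0)"
    unfolding dot_def using assms
    by (intro Sum_any.cong) (auto simp: mat_add_def mat_one_def mat_e_def inner_neq)
  then show ?thesis by simp
qed

text \<open>Two composable roots must lead from \<open>\<alpha>\<close> through an inner index to
  \<open>\<beta>\<close>, so only the central entry receives a correction to plain addition.\<close>

lemma mult_offdiag:
  assumes g: "g \<in> unitri (col \<union> row)" and h: "h \<in> unitri (col \<union> row)" and "a \<noteq> c"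
  shows "mat_mult g h a c = g a c + h a c + (if a = \<alpha> \<and> c = \<beta> then dot (g \<alpha>) h else 0)"
proof -
  have "(if b \<noteq> a \<and> b \<noteq> c then g a b * h b c else 0) =
      (if a = \<alpha> \<and> c = \<beta> \<and> inner b then g \<alpha> b * h b \<beta> else 0)" for b
  proof (cases "b \<noteq> a \<and> b \<noteq> c \<and> g a b * h b c \<noteq> 0")
    case True
    then have "g a b \<noteq> 0" "h b c \<noteq> 0" by auto
    with True have "(a, b) \<in> col \<union> row" "(b, c) \<in> col \<union> row"
      using g h by (metis unitri_offdiag)+
    then show ?thesis
      using True less unfolding in_roots_iff by (auto simp: inner_def)
  next
    case False
    then show ?thesis
      by (cases "a = \<alpha> \<and> c = \<beta> \<and> inner b") (auto simp: inner_neq)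
  qed
  then have "Sum_any (\<lambda>b. if b \<noteq> a \<and> b \<noteq> c then g a b * h b c else 0) =
      Sum_any (\<lambda>b. if a = \<alpha> \<and> c = \<beta> \<and> inner b then g \<alpha> b * h b \<beta> else 0)"
    by (rule Sum_any.cong)
  also have "\<dots> = (if a = \<alpha> \<and> c = \<beta> then dot (g \<alpha>) h else 0)"
    by (cases "a = \<alpha> \<and> c = \<beta>") (auto simp: dot_def Sum_any.expand_superset[of "{}"])
  finally show ?thesis
    using mat_mult_offdiag[OF assms] by simp
qed

lemma mult_diag:
  assumes "g \<in> unitri (col \<union> row)" "h \<in> unitri (col \<union> row)"
  shows "mat_mult g h a a = 1"
  using mat_mult_diag[OF roots_subset_Phi roots_subset_Phi assms] .

lemma mult_closed:
  assumes "g \<in> unitri (col \<union> row)" "h \<in> unitri (col \<union> row)"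
  shows "mat_mult g h \<in> unitri (col \<union> row)"
  using assms less by (intro mat_mult_in_unitri[OF roots_subset_Phi])
    (auto simp: in_col_iff in_row_iff inner_def)

section \<open>The column and row subgroups and their product\<close>

lemma unitri_col: "g \<in> unitri col \<longleftrightarrow> g \<in> unitri (col \<union> row) \<and> (\<forall>c. inner c \<longrightarrow> g \<alpha> c = 0)"
proof safe
  assume g: "g \<in> unitri col"
  then show "g \<in> unitri (col \<union> row)" by (auto simp: unitri_def)
  show "g \<alpha> c = 0" if "inner c" for c
    using that by (intro unitri_offdiag[OF g]) (auto simp: in_col_iff inner_def)
next
  assume g: "g \<in> unitri (col \<union> row)" and z: "\<forall>c. inner c \<longrightarrow> g \<alpha> c = 0"
  have "offdiag_supp g \<subseteq> col"
  proof
    fix p assume p: "p \<in> offdiag_supp g"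
    obtain a b where ab: "p = (a, b)" by force
    then have "g a b \<noteq> 0" "(a, b) \<in> col \<union> row"
      using p g by (auto simp: offdiag_supp_def unitri_def)
    then show "p \<in> col"
      using z unfolding ab in_roots_iff in_col_iff by auto
  qed
  then show "g \<in> unitri col"
    using g by (auto simp: unitri_def)
qed

lemma unitri_row: "g \<in> unitri row \<longleftrightarrow> g \<in> unitri (col \<union> row) \<and> (\<forall>c. inner c \<longrightarrow> g c \<beta> = 0)"
proof safe
  assume g: "g \<in> unitri row"
  then show "g \<in> unitri (col \<union> row)" by (auto simp: unitri_def)
  show "g c \<beta> = 0" if "inner c" for c
    using that by (intro unitri_offdiag[OF g]) (auto simp: in_row_iff inner_def)
next
  assume g: "g \<in> unitri (col \<union> row)" and z: "\<forall>c. inner c \<longrightarrow> g c \<beta> = 0"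
  have "offdiag_supp g \<subseteq> row"
  proof
    fix p assume p: "p \<in> offdiag_supp g"
    obtain a b where ab: "p = (a, b)" by force
    then have "g a b \<noteq> 0" "(a, b) \<in> col \<union> row"
      using p g by (auto simp: offdiag_supp_def unitri_def)
    then show "p \<in> row"
      using z unfolding ab in_roots_iff in_row_iff by auto
  qed
  then show "g \<in> unitri row"
    using g by (auto simp: unitri_def)
qed

lemma mclain_sub_col: "mclain_sub col = unitri col"
  using roots_subset_Phi less
  by (intro mclain_sub_noncomposable) (auto simp: noncomposable_def in_col_iff)

lemma mclain_sub_row: "mclain_sub row = unitri row"
  using roots_subset_Phi less
  by (intro mclain_sub_noncomposable) (auto simp: noncomposable_def in_row_iff)

lemma col_times_row: "unitri col <#>\<^bsub>mclain\<^esub> unitri row = (unitri (col \<union> row) :: ('l, 'r::ring_1) mat set)"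
proof (intro equalityI subsetI)
  fix g :: "('l, 'r) mat" assume "g \<in> unitri col <#>\<^bsub>mclain\<^esub> unitri row"
  then show "g \<in> unitri (col \<union> row)"
    by (auto simp: set_mult_def mult_mclain unitri_col unitri_row intro!: mult_closed)
next
  fix g :: "('l, 'r) mat" assume g: "g \<in> unitri (col \<union> row)"
  \<comment> \<open>\<open>?u\<close> keeps the column entries and the central entry,
    \<open>?v\<close> the inner row entries. In this order the cocycle term vanishes, as
    \<open>?u\<close> has no inner row entries.\<close>
  let ?u = "\<lambda>a b. if a = \<alpha> \<and> inner b then 0 else g a b"
  let ?v = "\<lambda>a b. if a = b \<or> a = \<alpha> \<and> inner b then g a b else 0"
  have "offdiag_supp ?u \<subseteq> offdiag_supp g" "offdiag_supp ?v \<subseteq> offdiag_supp g"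
    by (auto simp: offdiag_supp_def)
  then have uv: "?u \<in> unitri (col \<union> row)" "?v \<in> unitri (col \<union> row)"
    using g by (auto simp: unitri_def inner_neq elim: finite_subset)
  then have "?u \<in> unitri col" "?v \<in> unitri row"
    by (auto simp: unitri_col unitri_row inner_neq)
  moreover have "g = mat_mult ?u ?v"
  proof (intro ext)
    fix a c
    show "g a c = mat_mult ?u ?v a c"
    proof (cases "a = c")
      case True
      then show ?thesis using mult_diag[OF uv] g by (simp add: unitri_diag)
    next
      case False
      have "dot (?u \<alpha>) ?v = 0"
        by (rule dot_zero_left) simp
      then show ?thesis using mult_offdiag[OF uv False] False by auto
    qed
  qed
  ultimately show "g \<in> unitri col <#>\<^bsub>mclain\<^esub> unitri row"
    unfolding set_mult_def mult_mclain by blast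
qed

lemma carrier_mclain_ab: "carrier (mclain_ab \<alpha> \<beta>) = unitri (col \<union> row)"
  and mult_mclain_ab: "mult (mclain_ab \<alpha> \<beta>) = mat_mult"
  and one_mclain_ab: "\<one>\<^bsub>mclain_ab \<alpha> \<beta>\<^esub> = mat_one"
  by (simp_all add: mclain_ab_def mclain_sub_col mclain_sub_row col_times_row mult_mclain one_mclain)

lemma group_mclain_ab: "group (mclain_ab \<alpha> \<beta> :: ('l, 'r::ring_1) mat monoid)"
proof (rule groupI; unfold carrier_mclain_ab mult_mclain_ab one_mclain_ab)
  fix g h k :: "('l, 'r) mat"
  assume g: "g \<in> unitri (col \<union> row)" and h: "h \<in> unitri (col \<union> row)"
  show "mat_mult g h \<in> unitri (col \<union> row)"
    using g h by (rule mult_closed)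
  show "mat_mult (mat_mult g h) k = mat_mult g (mat_mult h k)"
    by (intro mat_mult_assoc finite_row) fact+
next
  fix g :: "('l, 'r) mat"
  assume g: "g \<in> unitri (col \<union> row)"
  \<comment> \<open>For triples \<open>(v, u, z)\<close> the left inverse is
    \<open>(- v, - u, v u - z)\<close>: the cocycle of \<open>- v\<close> with \<open>u\<close>
    cancels the summand \<open>v u\<close>.\<close>
  let ?i = "\<lambda>a b. if a = b then 1 else if a = \<alpha> \<and> b = \<beta> then dot (g \<alpha>) g - g a b else - g a b"
  have "offdiag_supp ?i \<subseteq> insert (\<alpha>, \<beta>) (offdiag_supp g)"
    by (auto simp: offdiag_supp_def)
  moreover have "(\<alpha>, \<beta>) \<in> col \<union> row"
    using in_roots_iff by blast
  ultimately have i: "?i \<in> unitri (col \<union> row)"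
    using g by (auto simp: unitri_def intro: finite_subset[of _ "insert (\<alpha>, \<beta>) (offdiag_supp g)"])
  have "mat_mult ?i g = mat_one"
  proof (intro ext)
    fix a c
    show "mat_mult ?i g a c = mat_one a c"
    proof (cases "a = c")
      case True
      then show ?thesis using mult_diag[OF i g] by (simp add: mat_one_def)
    next
      case False
      have "dot (?i \<alpha>) g + dot (g \<alpha>) g = 0"
        unfolding dot_add_left[OF g, symmetric]
        by (rule dot_zero_left) (auto simp: inner_neq)
      then show ?thesis using mult_offdiag[OF i g False] False less
        by (auto simp: mat_one_def algebra_simps)
    qed
  qed
  with i show "\<exists>h\<in>unitri (col \<union> row). mat_mult h g = mat_one" by blast
qed (simp_all add: mat_one_in_unitri mat_mult_one_left)

text \<open>The inner entries of the \<open>\<beta>\<close> column are additive on the whole group,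
  so their vanishing is preserved by conjugation.\<close>

lemma normal_row: "mclain_sub row \<lhd> (mclain_ab \<alpha> \<beta> :: ('l, 'r::ring_1) mat monoid)"
proof -
  interpret group "mclain_ab \<alpha> \<beta> :: ('l, 'r) mat monoid" by (rule group_mclain_ab)
  have entry: "(g \<otimes>\<^bsub>mclain_ab \<alpha> \<beta>\<^esub> h) c \<beta> = g c \<beta> + h c \<beta>"
    if "g \<in> carrier (mclain_ab \<alpha> \<beta>)" "h \<in> carrier (mclain_ab \<alpha> \<beta>)" "inner c"
    for g h :: "('l, 'r) mat" and c
    using that mult_offdiag[of g h c \<beta>] by (simp add: carrier_mclain_ab mult_mclain_ab inner_neq)
  have inv_entry: "g c \<beta> + (inv\<^bsub>mclain_ab \<alpha> \<beta>\<^esub> g) c \<beta> = 0"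
    if "g \<in> carrier (mclain_ab \<alpha> \<beta>)" "inner c" for g :: "('l, 'r) mat" and c
    using that entry[of g "inv\<^bsub>mclain_ab \<alpha> \<beta>\<^esub> g" c]
    by (simp add: one_mclain_ab mat_one_def inner_neq)
  have mem: "g \<in> mclain_sub row \<longleftrightarrow> g \<in> carrier (mclain_ab \<alpha> \<beta>) \<and> (\<forall>c. inner c \<longrightarrow> g c \<beta> = 0)"
    for g :: "('l, 'r) mat"
    by (simp add: mclain_sub_row unitri_row carrier_mclain_ab)
  show ?thesis
    unfolding normal_inv_iff
  proof (intro conjI ballI)
    show "subgroup (mclain_sub row) (mclain_ab \<alpha> \<beta> :: ('l, 'r) mat monoid)"
    proof (rule subgroupI)
      show "mclain_sub row \<noteq> ({} :: ('l, 'r) mat set)"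
        unfolding mclain_sub_row using mat_one_in_unitri by blast
      show "inv\<^bsub>mclain_ab \<alpha> \<beta>\<^esub> g \<in> mclain_sub row" if "g \<in> mclain_sub row" for g :: "('l, 'r) mat"
        using that inv_entry by (fastforce simp: mem)
    qed (auto simp: mem entry)
    show "g \<otimes>\<^bsub>mclain_ab \<alpha> \<beta>\<^esub> h \<otimes>\<^bsub>mclain_ab \<alpha> \<beta>\<^esub> inv\<^bsub>mclain_ab \<alpha> \<beta>\<^esub> g \<in> mclain_sub row"
      if "g \<in> carrier (mclain_ab \<alpha> \<beta>)" "h \<in> mclain_sub row" for g h :: "('l, 'r) mat"
      using that by (auto simp: mem entry inv_entry)
  qed
qed

end

section \<open>The monomial modules\<close>

abbreviation lookup :: "('a \<Rightarrow>\<^sub>0 'b::zero) \<Rightarrow> 'a \<Rightarrow> 'b" where "lookup \<equiv> Poly_Mapping.lookup"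
abbreviation keys :: "('a \<Rightarrow>\<^sub>0 'b::zero) \<Rightarrow> 'a set" where "keys \<equiv> Poly_Mapping.keys"
abbreviation single :: "'a \<Rightarrow> 'b \<Rightarrow> 'a \<Rightarrow>\<^sub>0 'b::zero" where "single \<equiv> Poly_Mapping.single"

locale root_character = mclain_root \<alpha> \<beta> for \<alpha> \<beta> :: "'l::order" +
  fixes lam :: "'r::ring_1 \<Rightarrow> 'f::field"
  assumes prim: "right_primitive lam"
begin

sublocale vs: vector_space "fscale :: 'f \<Rightarrow> (('l, 'r) mat \<Rightarrow>\<^sub>0 'f) \<Rightarrow> _"
  by (rule vector_space_fscale)

section \<open>Right primitivity and row vectors\<close>

lemma lam_add: "lam (x + y) = lam x * lam y" and lam_nonzero: "lam x \<noteq> 0"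
  using prim by (auto simp: right_primitive_def linear_character_def)

lemma lam_0: "lam 0 = 1"
  using lam_add[of 0 0] lam_nonzero[of 0] by simp

text \<open>The right ideal generated by \<open>x - y\<close> lies in the kernel of
  \<open>lam\<close>, so right primitivity forces it to be zero.\<close>

lemma eq_if_lam_mult_eq:
  assumes "\<And>s. lam (x * s) = lam (y * s)"
  shows "x = y"
proof -
  let ?I = "range (\<lambda>s. (x - y) * s)"
  have "lam ((x - y) * s) = 1" for s
  proof -
    have "lam (x * s) = lam ((x - y) * s + y * s)" by (simp add: algebra_simps)
    also have "\<dots> = lam ((x - y) * s) * lam (x * s)" by (simp add: lam_add assms)
    finally show ?thesis by (simp add: lam_nonzero)
  qed
  moreover have "right_ideal ?I"
    unfolding right_ideal_def
    by (auto simp: image_iff mult.assoc right_diff_distrib[symmetric] intro: exI[of _ 0])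
  ultimately have "?I = {0}"
    using prim by (auto simp: right_primitive_def)
  moreover have "(x - y) * 1 \<in> ?I" by blast
  ultimately show ?thesis by simp
qed

text \<open>Row vectors are stored as matrices concentrated in row \<open>\<alpha>\<close>, because
  the modules have to live in the vector space with basis \<open>('l, 'r) mat\<close>. Pointwise
  addition of functions is then addition of row vectors.\<close>

definition rowvecs :: "('l, 'r) mat set" where
  "rowvecs = {y. finite {c. y \<alpha> c \<noteq> 0} \<and> (\<forall>a b. y a b \<noteq> 0 \<longrightarrow> a = \<alpha> \<and> inner b)}"

lemma rowvecs_eq_0: "y \<in> rowvecs \<Longrightarrow> \<not> (a = \<alpha> \<and> inner b) \<Longrightarrow> y a b = 0"
  and rowvecs_finite: "y \<in> rowvecs \<Longrightarrow> finite {c. y \<alpha> c \<noteq> 0}"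
  by (simp_all add: rowvecs_def) blast

definition rowpart :: "('l, 'r) mat \<Rightarrow> ('l, 'r) mat" where
  "rowpart g = (\<lambda>a b. if a = \<alpha> \<and> inner b then g a b else 0)"

lemma zero_in_rowvecs: "0 \<in> rowvecs"
  by (simp add: rowvecs_def)

lemma rowvecs_add:
  assumes "x \<in> rowvecs" "y \<in> rowvecs"
  shows "x + y \<in> rowvecs"
proof -
  have "{c. (x + y) \<alpha> c \<noteq> 0} \<subseteq> {c. x \<alpha> c \<noteq> 0} \<union> {c. y \<alpha> c \<noteq> 0}"
    by auto
  moreover have "finite ({c. x \<alpha> c \<noteq> 0} \<union> {c. y \<alpha> c \<noteq> 0})"
    using assms by (simp add: rowvecs_def)
  ultimately have "finite {c. (x + y) \<alpha> c \<noteq> 0}"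
    by (rule finite_subset)
  moreover have "a = \<alpha> \<and> inner b" if "(x + y) a b \<noteq> 0" for a b
  proof -
    have "x a b \<noteq> 0 \<or> y a b \<noteq> 0" using that by auto
    then show ?thesis using assms unfolding rowvecs_def by blast
  qed
  ultimately show ?thesis unfolding rowvecs_def by blast
qed

lemma rowvecs_uminus: "x \<in> rowvecs \<Longrightarrow> - x \<in> rowvecs"
  by (auto simp: rowvecs_def)

lemma rowvecs_diff: "x \<in> rowvecs \<Longrightarrow> y \<in> rowvecs \<Longrightarrow> x - y \<in> rowvecs"
  using rowvecs_add[of x "- y"] rowvecs_uminus[of y] by simp

lemma rowvecs_eqI:
  assumes "x \<in> rowvecs" "y \<in> rowvecs" "\<And>c. inner c \<Longrightarrow> x \<alpha> c = y \<alpha> c"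
  shows "x = y"
proof (intro ext)
  fix a b
  show "x a b = y a b"
  proof (cases "a = \<alpha> \<and> inner b")
    case False
    then have "x a b = 0" "y a b = 0" using assms(1,2) by (simp_all add: rowvecs_eq_0)
    then show ?thesis by simp
  qed (use assms(3) in auto)
qed

lemma rowpart_in_rowvecs:
  assumes "g \<in> unitri \<Delta>"
  shows "rowpart g \<in> rowvecs"
proof -
  have "finite {c. rowpart g \<alpha> c \<noteq> 0}"
    by (rule finite_subset[OF _ finite_row[OF assms, of \<alpha>]]) (auto simp: rowpart_def)
  then show ?thesis by (auto simp: rowvecs_def rowpart_def)
qed

lemma rowpart_one: "rowpart mat_one = 0"
  by (auto simp: rowpart_def mat_one_def fun_eq_iff inner_def)

lemma rowpart_mult:
  assumes "g \<in> unitri (col \<union> row)" "h \<in> unitri (col \<union> row)"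
  shows "rowpart (mat_mult g h) = rowpart g + rowpart h"
  using mult_offdiag[OF assms] by (auto simp: rowpart_def fun_eq_iff inner_neq inner_neq(1)[symmetric])

lemma rowpart_col: "g \<in> unitri col \<Longrightarrow> rowpart g = 0"
  by (auto simp: unitri_col rowpart_def fun_eq_iff)

text \<open>Supplies a preimage under \<open>rowpart\<close> inside the row group, which makes the
  row group transitive on the lines of the basis vectors.\<close>

lemma one_plus_rowvec:
  assumes y: "y \<in> rowvecs"
  shows "mat_add mat_one y \<in> unitri row" "rowpart (mat_add mat_one y) = y"
proof -
  have supp: "offdiag_supp (mat_add mat_one y) \<subseteq> {\<alpha>} \<times> {c. y \<alpha> c \<noteq> 0}"
    using rowvecs_eq_0[OF y] unfolding offdiag_supp_def mat_add_def mat_one_def by fastforce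
  have "finite ({\<alpha>} \<times> {c. y \<alpha> c \<noteq> 0})"
    using rowvecs_finite[OF y] by simp
  moreover have "{\<alpha>} \<times> {c. y \<alpha> c \<noteq> 0} \<subseteq> row"
    using rowvecs_eq_0[OF y, of \<alpha>] by (auto simp: in_row_iff)
  moreover have "mat_add mat_one y a a = 1" for a
    using rowvecs_eq_0[OF y, of a a] by (auto simp: mat_add_def mat_one_def)
  ultimately show "mat_add mat_one y \<in> unitri row"
    using supp by (auto simp: unitri_def elim: finite_subset)
  show "rowpart (mat_add mat_one y) = y"
    using rowvecs_eq_0[OF y]
    by (auto simp: rowpart_def mat_add_def mat_one_def fun_eq_iff inner_neq(1)[symmetric])
qed

text \<open>
  The basis vector \<open>y\<close> spans a line on which the column group acts by the character
  \<open>phase f y\<close>; the group element \<open>g\<close> carries it to the line of \<open>y + rowpart g\<close>.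
\<close>

definition phase :: "('l \<Rightarrow> 'r) \<Rightarrow> ('l, 'r) mat \<Rightarrow> ('l, 'r) mat \<Rightarrow> 'f" where
  "phase f y g = lam (g \<alpha> \<beta> + dot (\<lambda>c. f c - y \<alpha> c) g)"

text \<open>Written by coefficients, so the translation appears inverted and the phase is taken at
  the target point; \<open>mono_act_single\<close> shows the effect on a basis vector.\<close>

definition mono_act :: "('l \<Rightarrow> 'r) \<Rightarrow> ('l, 'r) mat \<Rightarrow> (('l, 'r) mat \<Rightarrow>\<^sub>0 'f) \<Rightarrow> (('l, 'r) mat \<Rightarrow>\<^sub>0 'f)" where
  "mono_act f g p = Abs_poly_mapping (\<lambda>y. phase f y g * lookup p (y - rowpart g))"

definition mono_space :: "(('l, 'r) mat \<Rightarrow>\<^sub>0 'f) set" where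
  "mono_space = {p. keys p \<subseteq> rowvecs}"

definition mono_rep :: "('l \<Rightarrow> 'r) \<Rightarrow> (('l, 'r) mat, ('l, 'r) mat \<Rightarrow>\<^sub>0 'f) rep" where
  "mono_rep f = \<lparr>space = mono_space, act = mono_act f\<rparr>"

lemma space_mono_rep [simp]: "space (mono_rep f) = mono_space"
  and act_mono_rep [simp]: "act (mono_rep f) = mono_act f"
  by (simp_all add: mono_rep_def)

section \<open>Phases and the action of the group\<close>

lemma phase_nonzero: "phase f y g \<noteq> 0"
  by (simp add: phase_def lam_nonzero)

text \<open>The cocycle term \<open>dot (g \<alpha>) h\<close> of the product is absorbed by
  replacing \<open>y\<close> with \<open>y - rowpart g\<close> in the phase of \<open>h\<close>.
  This identity makes \<open>mono_act\<close> an action.\<close>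

lemma phase_mult:
  assumes g: "g \<in> unitri (col \<union> row)" and h: "h \<in> unitri (col \<union> row)"
  shows "phase f y (mat_mult g h) = phase f y g * phase f (y - rowpart g) h"
proof -
  let ?d = "dot (\<lambda>c. f c - y \<alpha> c)"
  have "?d (mat_mult g h) = ?d g + ?d h"
    using mult_offdiag[OF g h] by (intro dot_add_right[OF g h]) (auto simp: inner_neq)
  moreover have "mat_mult g h \<alpha> \<beta> = g \<alpha> \<beta> + h \<alpha> \<beta> + dot (g \<alpha>) h"
    using mult_offdiag[OF g h less_imp_neq[OF less]] by simp
  ultimately have "phase f y (mat_mult g h) = lam ((g \<alpha> \<beta> + ?d g) + (h \<alpha> \<beta> + (?d h + dot (g \<alpha>) h)))"
    by (simp only: phase_def ac_simps)
  also have "?d h + dot (g \<alpha>) h = dot (\<lambda>c. (f c - y \<alpha> c) + g \<alpha> c) h"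
    by (rule dot_add_left[OF h, symmetric])
  also have "\<dots> = dot (\<lambda>c. f c - (y - rowpart g) \<alpha> c) h"
    unfolding dot_def by (intro Sum_any.cong) (auto simp: rowpart_def diff_diff_eq2 diff_add_eq)
  finally show ?thesis
    by (simp only: phase_def lam_add)
qed

lemma phase_one: "phase f y mat_one = 1"
proof -
  have "mat_one \<alpha> \<beta> = (0 :: 'r)"
    using less by (auto simp: mat_one_def)
  moreover have "dot v mat_one = (0 :: 'r)" for v
    by (rule dot_zero_right) (auto simp: mat_one_def)
  ultimately show ?thesis
    by (simp add: phase_def lam_0)
qed

text \<open>The support lies in a translate of \<open>keys p\<close> and is therefore finite, which
  justifies \<open>Abs_poly_mapping\<close>.\<close>

lemma lookup_mono_act: "lookup (mono_act f g p) y = phase f y g * lookup p (y - rowpart g)"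
proof -
  have "{y. phase f y g * lookup p (y - rowpart g) \<noteq> 0} \<subseteq> (\<lambda>x. x + rowpart g) ` keys p"
  proof
    fix y assume "y \<in> {y. phase f y g * lookup p (y - rowpart g) \<noteq> 0}"
    then have "y - rowpart g \<in> keys p" by (auto simp: in_keys_iff)
    moreover have "y = (y - rowpart g) + rowpart g" by simp
    ultimately show "y \<in> (\<lambda>x. x + rowpart g) ` keys p" by blast
  qed
  then have "finite {y. phase f y g * lookup p (y - rowpart g) \<noteq> 0}"
    by (rule finite_subset) simp
  then show ?thesis
    by (simp add: mono_act_def)
qed

lemma mono_act_single:
  "mono_act f g (single y c) =
    single (y + rowpart g) (phase f (y + rowpart g) g * c)"
  by (intro poly_mapping_eqI) (auto simp: lookup_mono_act lookup_single when_def algebra_simps)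

lemma lookup_mono_act_col:
  "g \<in> unitri col \<Longrightarrow> lookup (mono_act f g p) y = phase f y g * lookup p y"
  by (simp add: lookup_mono_act rowpart_col)

lemma mono_act_add: "mono_act f g (p + q) = mono_act f g p + mono_act f g q"
  by (intro poly_mapping_eqI) (simp add: lookup_mono_act lookup_add distrib_left)

lemma mono_act_scale: "mono_act f g (fscale c p) = fscale c (mono_act f g p)"
  by (intro poly_mapping_eqI) (simp add: lookup_mono_act lookup_fscale)

lemma mono_act_one: "mono_act f mat_one p = p"
  by (intro poly_mapping_eqI) (simp add: lookup_mono_act rowpart_one phase_one)

lemma mono_act_mult:
  assumes "g \<in> unitri (col \<union> row)" "h \<in> unitri (col \<union> row)"
  shows "mono_act f (mat_mult g h) p = mono_act f g (mono_act f h p)"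
  by (intro poly_mapping_eqI)
    (simp add: lookup_mono_act rowpart_mult[OF assms] phase_mult[OF assms] diff_diff_eq mult.assoc)

lemma mono_spaceI: "(\<And>y. lookup p y \<noteq> 0 \<Longrightarrow> y \<in> rowvecs) \<Longrightarrow> p \<in> mono_space"
  and mono_spaceD: "p \<in> mono_space \<Longrightarrow> lookup p y \<noteq> 0 \<Longrightarrow> y \<in> rowvecs"
  by (auto simp: mono_space_def in_keys_iff)

section \<open>The monomial module and its irreducibility\<close>

lemma subspace_mono_space: "vs.subspace mono_space"
proof (rule vs.subspaceI)
  show "p + q \<in> mono_space" if "p \<in> mono_space" "q \<in> mono_space" for p q
    using that mono_spaceD[of p] mono_spaceD[of q]
    by (intro mono_spaceI) (metis add_0 lookup_add)
  show "fscale c p \<in> mono_space" if "p \<in> mono_space" for c p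
    using that by (auto intro!: mono_spaceI simp: lookup_fscale dest: mono_spaceD)
qed (simp add: mono_space_def)

lemma mono_act_in_space:
  assumes "g \<in> unitri \<Delta>" "p \<in> mono_space"
  shows "mono_act f g p \<in> mono_space"
proof (rule mono_spaceI)
  fix y assume "lookup (mono_act f g p) y \<noteq> 0"
  then have "y - rowpart g \<in> rowvecs"
    using assms(2) by (auto simp: lookup_mono_act dest: mono_spaceD)
  from rowvecs_add[OF this rowpart_in_rowvecs[OF assms(1)]] show "y \<in> rowvecs" by simp
qed

lemma single_in_space: "y \<in> rowvecs \<Longrightarrow> single y c \<in> mono_space"
  by (auto simp: mono_space_def split: if_splits)

lemma group_module_mono_rep: "group_module fscale (mclain_ab \<alpha> \<beta>) (mono_rep f)"
  unfolding group_module_def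
  using group_mclain_ab subspace_mono_space vector_space_fscale
  by (auto simp: carrier_mclain_ab mult_mclain_ab one_mclain_ab mono_act_in_space mono_act_add
      mono_act_scale mono_act_one mono_act_mult)

text \<open>Elementary column matrices probe one coordinate of \<open>f - y\<close> at a time, with
  a free multiplier \<open>s\<close> from the right as right primitivity demands.\<close>

lemma elementary_col:
  assumes "inner c"
  shows "mat_add mat_one (mat_e s c \<beta>) \<in> unitri col"
    and "phase f y (mat_add mat_one (mat_e s c \<beta>)) = lam ((f c - y \<alpha> c) * s)"
proof -
  show "mat_add mat_one (mat_e s c \<beta>) \<in> unitri col"
    using assms by (intro elementary_in_unitri) (auto simp: in_col_iff inner_def)
  have "mat_add mat_one (mat_e s c \<beta>) \<alpha> \<beta> = 0"
    using assms less by (auto simp: mat_add_def mat_one_def mat_e_def inner_def)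
  then show "phase f y (mat_add mat_one (mat_e s c \<beta>)) = lam ((f c - y \<alpha> c) * s)"
    using assms by (simp add: phase_def dot_elementary)
qed

text \<open>Distinct row vectors differ at some inner coordinate, and right primitivity provides a
  multiplier \<open>s\<close> at which \<open>lam\<close> detects the difference.\<close>

lemma phase_separates:
  assumes "y \<in> rowvecs" "z \<in> rowvecs" "y \<noteq> z"
  obtains g where "g \<in> unitri col" "phase f y g \<noteq> phase f z g"
proof -
  obtain c where c: "inner c" "y \<alpha> c \<noteq> z \<alpha> c"
    using rowvecs_eqI assms by blast
  then have "f c - y \<alpha> c \<noteq> f c - z \<alpha> c" by simp
  then obtain s where "lam ((f c - y \<alpha> c) * s) \<noteq> lam ((f c - z \<alpha> c) * s)"
    using eq_if_lam_mult_eq by blast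
  then show thesis
    using elementary_col[OF c(1)] by (intro that) auto
qed

lemma unitri_col_subset: "unitri col \<subseteq> unitri (col \<union> row)"
  and unitri_row_subset: "unitri row \<subseteq> unitri (col \<union> row)"
  by (auto intro: unitri_mono[THEN subsetD, rotated])

lemma gsubmodule_mono_repD:
  assumes "gsubmodule fscale G (mono_rep f) U"
  shows "vs.subspace U" "U \<subseteq> mono_space" "g \<in> carrier G \<Longrightarrow> p \<in> U \<Longrightarrow> mono_act f g p \<in> U"
  using assms by (auto simp: gsubmodule_def)

lemma subspace_single:
  assumes "vs.subspace U" "single y c \<in> U" "c \<noteq> 0"
  shows "single y d \<in> U"
proof -
  have "single y d = fscale (d / c) (single y c)"
    using assms(3) by (intro poly_mapping_eqI) (simp add: lookup_fscale lookup_single when_def)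
  then show ?thesis
    using vs.subspace_scale[OF assms(1,2)] by simp
qed

lemma sum_single_lookup: "(\<Sum>y\<in>keys p. single y (lookup p y)) = p"
proof (rule poly_mapping_eqI)
  fix x
  show "lookup (\<Sum>y\<in>keys p. single y (lookup p y)) x = lookup p x"
    by (cases "x \<in> keys p") (auto simp: lookup_sum lookup_single when_def in_keys_iff)
qed

lemma mono_space_subset:
  assumes "vs.subspace U" "\<And>y d. y \<in> rowvecs \<Longrightarrow> single y d \<in> U"
  shows "mono_space \<subseteq> U"
proof
  fix p assume "p \<in> mono_space"
  then have "(\<Sum>y\<in>keys p. single y (lookup p y)) \<in> U"
    using assms by (intro vs.subspace_sum) (auto simp: mono_space_def)
  then show "p \<in> U" by (simp only: sum_single_lookup)
qed

text \<open>
  A nonzero vector of minimal support in a submodule is supported on a single basis vector, as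
  otherwise some element of the column group separates two points of its support.
\<close>

lemma gsubmodule_mono_rep:
  assumes U: "gsubmodule fscale (mclain_ab \<alpha> \<beta>) (mono_rep f) U" and "U \<noteq> {0}"
  shows "U = mono_space"
proof
  note sub = gsubmodule_mono_repD(1)[OF U] and act = gsubmodule_mono_repD(3)[OF U, unfolded carrier_mclain_ab]
  show US: "U \<subseteq> mono_space" by (rule gsubmodule_mono_repD(2)[OF U])
  obtain p0 where "p0 \<in> U \<and> p0 \<noteq> 0"
    using assms(2) vs.subspace_0[OF sub] by blast
  then obtain p where p: "p \<in> U" "p \<noteq> 0"
    and min: "\<And>q. q \<in> U \<Longrightarrow> q \<noteq> 0 \<Longrightarrow> card (keys p) \<le> card (keys q)"
    using ex_has_least_nat[of "\<lambda>q. q \<in> U \<and> q \<noteq> 0" p0 "\<lambda>q. card (keys q)"] by blast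
  obtain y where y: "y \<in> keys p" using p(2) keys_eq_empty[of p] by blast
  have "z = y" if z: "z \<in> keys p" for z
  proof (rule ccontr)
    assume "z \<noteq> y"
    moreover have "y \<in> rowvecs" "z \<in> rowvecs"
      using y z p US by (auto simp: mono_space_def)
    ultimately obtain g where g: "g \<in> unitri col" "phase f z g \<noteq> phase f y g"
      by (metis phase_separates)
    \<comment> \<open>\<open>g\<close> acts diagonally; subtracting its eigenvalue at
      \<open>y\<close> removes \<open>y\<close> from the support, keeps \<open>z\<close>, and adds
      no new points.\<close>
    let ?q = "mono_act f g p - fscale (phase f y g) p"
    have lookup: "lookup ?q x = (phase f x g - phase f y g) * lookup p x" for x
      using g(1) by (simp add: lookup_minus lookup_mono_act_col lookup_fscale left_diff_distrib)
    have "?q \<in> U"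
      using g(1) unitri_col_subset p(1) act by (intro vs.subspace_diff vs.subspace_scale sub) auto
    moreover have "z \<in> keys ?q"
      using z g(2) by (auto simp: in_keys_iff lookup)
    moreover have "keys ?q \<subset> keys p"
      using y by (auto simp: in_keys_iff lookup)
    then have "card (keys ?q) < card (keys p)"
      by (intro psubset_card_mono) auto
    ultimately show False
      using min[of ?q] keys_eq_empty[of ?q] by (metis empty_iff not_less)
  qed
  then have p_single: "p = single y (lookup p y)"
    by (intro poly_mapping_eqI) (auto simp: lookup_single when_def in_keys_iff)
  show "mono_space \<subseteq> U"
  proof (rule mono_space_subset[OF sub])
    fix z d assume z: "z \<in> rowvecs"
    \<comment> \<open>Translation by \<open>z - y\<close> carries the line of \<open>y\<close> to
      the line of \<open>z\<close>.\<close>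
    let ?g = "mat_add mat_one (z - y)"
    have "z - y \<in> rowvecs"
      using z y p US by (auto simp: mono_space_def intro: rowvecs_diff)
    note g = one_plus_rowvec[OF this]
    have "mono_act f ?g p \<in> U"
      using act p(1) g(1) unitri_row_subset by blast
    moreover have "mono_act f ?g p = single z (phase f z ?g * lookup p y)"
      by (subst p_single) (simp add: mono_act_single g(2))
    ultimately show "single z d \<in> U"
      using sub y by (auto intro!: subspace_single[of U z "phase f z ?g * lookup p y"] simp: in_keys_iff phase_nonzero)
  qed
qed

lemma single_1_neq_0: "single y (1 :: 'f) \<noteq> 0"
  by (metis lookup_single_eq lookup_zero one_neq_zero)

lemma irreducible_mono_rep: "irreducible_gmodule fscale (mclain_ab \<alpha> \<beta>) (mono_rep f)"
  unfolding irreducible_gmodule_def irreducible_gsubmodule_def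
proof (intro conjI allI impI group_module_mono_rep)
  show "gsubmodule fscale (mclain_ab \<alpha> \<beta>) (mono_rep f) (space (mono_rep f))"
    by (auto simp: gsubmodule_def subspace_mono_space carrier_mclain_ab mono_act_in_space)
  show "space (mono_rep f) \<noteq> {0}"
    using single_in_space[OF zero_in_rowvecs, of 1] single_1_neq_0[of 0] by auto
qed (use gsubmodule_mono_rep in auto)

section \<open>Lines of basis vectors and restriction to the column group\<close>

definition line :: "('l, 'r) mat \<Rightarrow> (('l, 'r) mat \<Rightarrow>\<^sub>0 'f) set" where
  "line y = range (single y)"

lemma line_eq_span: "line y = vs.span {single y 1}"
proof -
  have "fscale c (single y 1) = single y c" for c :: 'f
    by (intro poly_mapping_eqI) (simp add: lookup_fscale lookup_single when_def)
  then show ?thesis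
    by (simp add: line_def vs.span_singleton)
qed

lemma subspace_line: "vs.subspace (line y)"
  by (simp add: line_eq_span)

text \<open>The elementary matrix at the root \<open>(\<alpha>, \<beta>)\<close> has zero row part
  and no inner entries in the \<open>\<beta>\<close> column, so its phase is just
  \<open>lam r\<close>. The line of the zero row vector serves as the submodule.\<close>

lemma lies_over_mono_rep: "lies_over fscale \<alpha> \<beta> lam (mono_rep f)"
  unfolding lies_over_def
proof (intro exI[of _ "line 0"] conjI allI ballI)
  have act: "act (mono_rep f) (mat_add mat_one (mat_e r \<alpha> \<beta>)) w = fscale (lam r) w"
    if "w \<in> line 0" for r w
  proof -
    let ?g = "mat_add mat_one (mat_e r \<alpha> \<beta>)"
    have "?g \<in> unitri col"
      using less by (intro elementary_in_unitri) (auto simp: in_col_iff)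
    moreover have "phase f 0 ?g = lam r"
      using less by (subst phase_def, subst dot_zero_right)
        (auto simp: mat_add_def mat_one_def mat_e_def inner_neq less_imp_neq)
    ultimately show ?thesis
      using that by (intro poly_mapping_eqI)
        (auto simp: lookup_mono_act_col lookup_fscale line_def lookup_single when_def)
  qed
  then show "act (mono_rep f) (mat_add mat_one (mat_e r \<alpha> \<beta>)) w = fscale (lam r) w"
    if "w \<in> line 0" for r w
    using that .
  show "gsubmodule fscale (subgrp (root_subgroup \<alpha> \<beta>)) (mono_rep f) (line 0)"
    unfolding gsubmodule_def
  proof (intro conjI ballI subspace_line)
    show "line 0 \<subseteq> space (mono_rep f)"
      by (auto simp: line_def single_in_space zero_in_rowvecs)
    show "act (mono_rep f) g w \<in> line 0"
      if "g \<in> carrier (subgrp (root_subgroup \<alpha> \<beta>))" "w \<in> line 0" for g w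
      using that act vs.subspace_scale[OF subspace_line] by (auto simp: root_subgroup_def)
  qed
  show "vs.dim (line 0) = 1"
    using single_1_neq_0[of 0]
    by (simp add: line_eq_span vs.dim_eq_card_independent)
qed

lemma line_subset_space: "y \<in> rowvecs \<Longrightarrow> line y \<subseteq> mono_space"
  by (auto simp: line_def single_in_space)

text \<open>Column elements have zero row part and hence preserve each line; a line has no proper
  nonzero subspace.\<close>

lemma irreducible_line:
  assumes "y \<in> rowvecs"
  shows "irreducible_gsubmodule fscale (subgrp (unitri col)) (mono_rep f) (line y)"
  unfolding irreducible_gsubmodule_def
proof (intro conjI allI impI)
  have "mono_act f g (single y c) \<in> line y" if "g \<in> unitri col" for g c
    using that by (simp add: mono_act_single rowpart_col line_def)
  then show "gsubmodule fscale (subgrp (unitri col)) (mono_rep f) (line y)"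
    using assms by (auto simp: gsubmodule_def subspace_line dest: line_subset_space) (auto simp: line_def)
  show "line y \<noteq> {0}"
    using single_1_neq_0[of y] by (auto simp: line_def)
  fix U assume U: "gsubmodule fscale (subgrp (unitri col)) (mono_rep f) U \<and> U \<subseteq> line y"
  then have sub: "vs.subspace U" by (auto simp: gsubmodule_def)
  show "U = {0} \<or> U = line y"
  proof (cases "U = {0}")
    case False
    then obtain p where "p \<in> U" "p \<noteq> 0"
      using vs.subspace_0[OF sub] by blast
    moreover from this obtain c where "p = single y c"
      using U by (auto simp: line_def)
    ultimately have "single y d \<in> U" for d
      using subspace_single[OF sub, of y c d] by (metis single_zero)
    then show ?thesis
      using U by (auto simp: line_def)
  qed simp
qed

text \<open>The basis consists of common eigenvectors of the column group, so the lines they span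
  are the irreducible summands.\<close>

lemma completely_reducible_col:
  "completely_reducible fscale (subgrp (mclain_sub col)) (mono_rep f)"
  unfolding completely_reducible_def mclain_sub_col
proof (intro exI[of _ "line ` rowvecs"] conjI)
  show "\<forall>W\<in>line ` rowvecs. irreducible_gsubmodule fscale (subgrp (unitri col)) (mono_rep f) W"
    using irreducible_line by auto
  have "mono_space \<subseteq> vs.span (\<Union> (line ` rowvecs))"
    by (rule mono_space_subset) (auto simp: line_def intro!: vs.span_base)
  moreover have "vs.span (\<Union> (line ` rowvecs)) \<subseteq> mono_space"
    using line_subset_space by (intro vs.span_minimal subspace_mono_space) auto
  ultimately show "vs.span (\<Union> (line ` rowvecs)) = space (mono_rep f)"
    by simp
  show "\<forall>W\<in>line ` rowvecs. W \<inter> vs.span (\<Union> (line ` rowvecs - {W})) = {0}"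
  proof
    fix W assume "W \<in> line ` rowvecs"
    then obtain y where y: "y \<in> rowvecs" "W = line y" by auto
    \<comment> \<open>The coordinate at \<open>y\<close> vanishes on every other line but is
      injective on \<open>line y\<close>; this gives independence.\<close>
    have "vs.subspace {p. lookup p y = 0}"
      by (rule vs.subspaceI) (auto simp: lookup_add lookup_fscale)
    moreover have "\<Union> (line ` rowvecs - {W}) \<subseteq> {p. lookup p y = 0}"
    proof
      fix p assume "p \<in> \<Union> (line ` rowvecs - {W})"
      then obtain x where "p \<in> line x" "x \<noteq> y"
        using y by auto
      then show "p \<in> {p. lookup p y = 0}"
        by (auto simp: line_def lookup_single when_def)
    qed
    ultimately have "vs.span (\<Union> (line ` rowvecs - {W})) \<subseteq> {p. lookup p y = 0}"
      by (intro vs.span_minimal)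
    then have "W \<inter> vs.span (\<Union> (line ` rowvecs - {W})) \<subseteq> {0}"
      using y by (auto simp: line_def)
    moreover have "0 \<in> W"
      using y vs.subspace_0[OF subspace_line] by simp
    ultimately show "W \<inter> vs.span (\<Union> (line ` rowvecs - {W})) = {0}"
      using vs.span_zero by auto
  qed
qed

section \<open>Restriction to the row group and isomorphisms\<close>

text \<open>
  The sum of the coefficients of \<open>w\<close> along a line in the coordinate direction \<open>c\<close>. It is
  invariant under translation in that direction, hence vanishes on \<open>mono_act f t w - w\<close> for
  the elementary matrix \<open>t\<close> at \<open>(\<alpha>, c)\<close>; it does not vanish identically on a vector
  whose support lies in the hyperplane where the coordinate \<open>c\<close> is \<open>0\<close>.
\<close>

definition line_sum :: "'l \<Rightarrow> (('l, 'r) mat \<Rightarrow>\<^sub>0 'f) \<Rightarrow> ('l, 'r) mat \<Rightarrow> 'f" where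
  "line_sum c w x = Sum_any (\<lambda>r. lookup w (x + mat_e r \<alpha> c))"

lemma mat_e_in_rowvecs: "inner c \<Longrightarrow> mat_e r \<alpha> c \<in> rowvecs"
  unfolding rowvecs_def mat_e_def
  by (auto intro: rev_finite_subset[of "{c}"] split: if_splits)

lemma mat_e_diff: "mat_e (r - s) a c = mat_e r a c - (mat_e s a c :: ('l, 'r) mat)"
  by (auto simp: mat_e_def fun_eq_iff)

lemma finite_line_sum: "finite {r. lookup w (x + mat_e r \<alpha> c) \<noteq> 0}"
proof -
  have "inj (\<lambda>r. x + mat_e r \<alpha> c)"
  proof (rule injI)
    fix r s assume "x + mat_e r \<alpha> c = x + mat_e s \<alpha> c"
    then have "mat_e r \<alpha> c \<alpha> c = mat_e s \<alpha> c \<alpha> c" by simp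
    then show "r = s" by (simp add: mat_e_def)
  qed
  then have "finite ((\<lambda>r. x + mat_e r \<alpha> c) -` keys w)"
    by (intro finite_vimageI) auto
  then show ?thesis
    by (simp add: vimage_def in_keys_iff)
qed

lemma line_sum_add: "line_sum c (v + w) x = line_sum c v x + line_sum c w x"
  by (simp add: line_sum_def lookup_add Sum_any.distrib[OF finite_line_sum finite_line_sum])

lemma line_sum_scale: "line_sum c (fscale k w) x = k * line_sum c w x"
  by (simp add: line_sum_def lookup_fscale Sum_any_right_distrib[OF finite_line_sum])

lemma line_sum_diff: "line_sum c (v - w) x = line_sum c v x - line_sum c w x"
  using line_sum_add[of c "v - w" w x] by simp

lemma phase_row: "g \<in> unitri row \<Longrightarrow> phase f y g = lam (g \<alpha> \<beta>)"
  by (simp add: phase_def dot_zero_right unitri_row)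

text \<open>On the row group the phase does not depend on the row vector and can be taken out of the
  sum. Hence the common kernel of the line sums is stable under the row group.\<close>

lemma line_sum_row:
  assumes "g \<in> unitri row"
  shows "line_sum c (mono_act f g w) x = lam (g \<alpha> \<beta>) * line_sum c w (x - rowpart g)"
proof -
  have "line_sum c (mono_act f g w) x =
      Sum_any (\<lambda>r. lam (g \<alpha> \<beta>) * lookup w ((x - rowpart g) + mat_e r \<alpha> c))"
    unfolding line_sum_def
    by (intro Sum_any.cong) (simp add: lookup_mono_act phase_row[OF assms] diff_add_eq)
  then show ?thesis
    by (simp add: line_sum_def Sum_any_right_distrib[OF finite_line_sum])
qed

lemma line_sum_translate: "line_sum c w (x - mat_e s \<alpha> c) = line_sum c w x"
  unfolding line_sum_def
proof (rule Sum_any.reindex_cong[symmetric])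
  show "bij (\<lambda>r. r - s)"
    by (rule o_bij[of "\<lambda>r. r + s"]) auto
  show "(\<lambda>r. lookup w (x + mat_e r \<alpha> c)) \<circ> (\<lambda>r. r - s) = (\<lambda>r. lookup w (x - mat_e s \<alpha> c + mat_e r \<alpha> c))"
    by (auto simp: mat_e_diff fun_eq_iff algebra_simps)
qed

lemma line_sum_eq_lookup:
  assumes "\<And>z. z \<in> keys w \<Longrightarrow> z \<alpha> c = 0" "x \<alpha> c = 0"
  shows "line_sum c w x = lookup w x"
proof -
  have "lookup w (x + mat_e r \<alpha> c) = (if r = 0 then lookup w x else 0)" for r
  proof (cases "r = 0")
    case True
    then have "x + mat_e r \<alpha> c = x" by (auto simp: mat_e_def fun_eq_iff)
    then show ?thesis using True by simp
  next
    case False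
    then have "(x + mat_e r \<alpha> c) \<alpha> c \<noteq> 0" using assms(2) by (simp add: mat_e_def)
    then have "x + mat_e r \<alpha> c \<notin> keys w" using assms(1) by blast
    then show ?thesis using False by (simp add: in_keys_iff)
  qed
  then have "line_sum c w x = Sum_any (\<lambda>r :: 'r. if r = 0 then lookup w x else 0)"
    unfolding line_sum_def by (rule Sum_any.cong)
  then show ?thesis by simp
qed

text \<open>For a suitable direction \<open>c\<close>, the vectors of \<open>W\<close> whose line
  sums all vanish form a submodule strictly between \<open>{0}\<close> and \<open>W\<close>.\<close>

lemma not_irreducible_row:
  assumes inf: "infinite {c. inner c}"
  shows "\<not> irreducible_gsubmodule fscale (subgrp (mclain_sub row)) (mono_rep f) W"
proof
  assume irr: "irreducible_gsubmodule fscale (subgrp (mclain_sub row)) (mono_rep f) W"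
  then have W: "gsubmodule fscale (subgrp (unitri row)) (mono_rep f) W" and "W \<noteq> {0}"
    and min: "\<And>U. gsubmodule fscale (subgrp (unitri row)) (mono_rep f) U \<Longrightarrow> U \<subseteq> W \<Longrightarrow> U = {0} \<or> U = W"
    unfolding irreducible_gsubmodule_def mclain_sub_row by blast+
  note sub = gsubmodule_mono_repD(1)[OF W] and WS = gsubmodule_mono_repD(2)[OF W]
  have act: "mono_act f g w \<in> W" if "g \<in> unitri row" "w \<in> W" for g w
    using gsubmodule_mono_repD(3)[OF W] that by simp
  obtain p where p: "p \<in> W" "p \<noteq> 0"
    using \<open>W \<noteq> {0}\<close> vs.subspace_0[OF sub] by blast
  then obtain y where y: "y \<in> keys p"
    using keys_eq_empty[of p] by blast
  have "finite (\<Union>z\<in>keys p. {c. z \<alpha> c \<noteq> 0})"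
    using p(1) WS by (auto simp: mono_space_def intro: rowvecs_finite)
  then have "\<not> {c. inner c} \<subseteq> (\<Union>z\<in>keys p. {c. z \<alpha> c \<noteq> 0})"
    using inf finite_subset by blast
  then obtain c where c: "inner c" "\<And>z. z \<in> keys p \<Longrightarrow> z \<alpha> c = 0"
    by blast
  let ?t = "mat_add mat_one (mat_e 1 \<alpha> c) :: ('l, 'r) mat"
  note t = one_plus_rowvec[OF mat_e_in_rowvecs[OF c(1), of 1]]
  have t_entry: "?t \<alpha> \<beta> = 0"
    using c(1) less by (auto simp: mat_add_def mat_one_def mat_e_def inner_def)
  let ?U = "{w \<in> W. \<forall>x. line_sum c w x = 0}"
  have "gsubmodule fscale (subgrp (unitri row)) (mono_rep f) ?U"
    unfolding gsubmodule_def
  proof (intro conjI ballI)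
    show "vs.subspace ?U"
    proof (rule vs.subspaceI)
      show "0 \<in> ?U"
        using vs.subspace_0[OF sub] by (simp add: line_sum_def)
      show "v + w \<in> ?U" if "v \<in> ?U" "w \<in> ?U" for v w
        using that vs.subspace_add[OF sub] by (simp add: line_sum_add)
      show "fscale k w \<in> ?U" if "w \<in> ?U" for k w
        using that vs.subspace_scale[OF sub] by (simp add: line_sum_scale)
    qed
    show "?U \<subseteq> space (mono_rep f)" using WS by auto
    show "act (mono_rep f) g w \<in> ?U" if "g \<in> carrier (subgrp (unitri row))" "w \<in> ?U" for g w
      using that act by (simp add: line_sum_row)
  qed
  then have "?U = {0} \<or> ?U = W"
    by (intro min) auto
  moreover have "p \<notin> ?U"
  proof -
    have "line_sum c p y = lookup p y"
      using c(2) y by (intro line_sum_eq_lookup) auto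
    then have "line_sum c p y \<noteq> 0"
      using y by (simp add: in_keys_iff)
    then show ?thesis by blast
  qed
  moreover have "?U \<noteq> {0}"
  proof -
    \<comment> \<open>Since the line sums do not change under translation in direction
      \<open>c\<close>, this difference lies in \<open>?U\<close>. It is nonzero because
      \<open>1 \<noteq> 0\<close> moves the support of \<open>p\<close> off the hyperplane where the
      coordinate \<open>c\<close> is 0.\<close>
    let ?q = "mono_act f ?t p - p"
    have "?q \<in> W"
      using act[OF t(1) p(1)] p(1) by (intro vs.subspace_diff sub)
    moreover have "line_sum c ?q x = 0" for x
      by (simp add: line_sum_diff line_sum_row[OF t(1)] t(2) t_entry lam_0
          line_sum_translate)
    moreover have "?q \<noteq> 0"
    proof
      assume "?q = 0"
      then have "lookup ?q y = 0" by simp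
      moreover have "(y - mat_e 1 \<alpha> c) \<alpha> c \<noteq> 0"
        using c(2)[OF y] by (simp add: mat_e_def)
      then have "y - mat_e 1 \<alpha> c \<notin> keys p"
        using c(2) by blast
      ultimately show False
        using y by (simp add: lookup_minus lookup_mono_act t(2) in_keys_iff)
    qed
    ultimately show ?thesis by blast
  qed
  ultimately show False
    using p(1) by blast
qed

text \<open>Without irreducible submodules the family of summands would be empty, and its span
  zero.\<close>

lemma not_completely_reducible_row:
  assumes "infinite {c. inner c}"
  shows "\<not> completely_reducible fscale (subgrp (mclain_sub row)) (mono_rep f)"
proof
  assume "completely_reducible fscale (subgrp (mclain_sub row)) (mono_rep f)"
  then obtain \<W> where
    irr: "\<forall>W\<in>\<W>. irreducible_gsubmodule fscale (subgrp (mclain_sub row)) (mono_rep f) W"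
    and span: "vs.span (\<Union>\<W>) = mono_space"
    by (auto simp: completely_reducible_def)
  have "\<W> = {}"
    using irr not_irreducible_row[OF assms] by blast
  then have "mono_space = {0}"
    using span by simp
  then show False
    using single_in_space[OF zero_in_rowvecs, of 1] single_1_neq_0[of 0] by auto
qed

text \<open>The weights of the column group on the two modules determine \<open>f\<close> and \<open>f'\<close> up to a row vector.\<close>

lemma finite_neq_if_iso:
  assumes "gmodule_iso fscale (mclain_ab \<alpha> \<beta>) (mono_rep f) (mono_rep f')"
  shows "finite {c. inner c \<and> f c \<noteq> f' c}"
proof -
  obtain \<phi> where bij: "bij_betw \<phi> mono_space mono_space"
    and add: "\<And>v w. v \<in> mono_space \<Longrightarrow> w \<in> mono_space \<Longrightarrow> \<phi> (v + w) = \<phi> v + \<phi> w"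
    and scale: "\<And>k v. v \<in> mono_space \<Longrightarrow> \<phi> (fscale k v) = fscale k (\<phi> v)"
    and act: "\<And>g v. g \<in> unitri (col \<union> row) \<Longrightarrow> v \<in> mono_space \<Longrightarrow> \<phi> (mono_act f g v) = mono_act f' g (\<phi> v)"
    using assms by (auto simp: gmodule_iso_def carrier_mclain_ab)
  let ?b = "single 0 1 :: ('l, 'r) mat \<Rightarrow>\<^sub>0 'f"
  have b: "?b \<in> mono_space"
    by (rule single_in_space[OF zero_in_rowvecs])
  have zero: "0 \<in> mono_space"
    by (rule vs.subspace_0[OF subspace_mono_space])
  have "\<phi> 0 = 0"
    using add[OF zero zero] by simp
  then have "\<phi> ?b \<noteq> 0"
    using bij b zero single_1_neq_0[of 0] by (metis bij_betw_imp_inj_on inj_onD)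
  then obtain y where y: "y \<in> keys (\<phi> ?b)"
    using keys_eq_empty[of "\<phi> ?b"] by blast
  moreover have "\<phi> ?b \<in> mono_space"
    using bij b by (auto simp: bij_betw_def)
  ultimately have y_row: "y \<in> rowvecs"
    by (auto simp: mono_space_def)
  \<comment> \<open>\<open>?b\<close> is an eigenvector of the column group, hence so is its image;
    comparing coefficients at the point \<open>y\<close> of the support identifies the two
    characters.\<close>
  have phase: "phase f 0 g = phase f' y g" if g: "g \<in> unitri col" for g
  proof -
    have "mono_act f g ?b = fscale (phase f 0 g) ?b"
      using g by (intro poly_mapping_eqI)
        (auto simp: lookup_mono_act_col lookup_fscale lookup_single when_def simp del: single_one)
    then have "fscale (phase f 0 g) (\<phi> ?b) = mono_act f' g (\<phi> ?b)"
      using act[OF _ b, of g] scale[OF b] g unitri_col_subset by auto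
    then have "lookup (fscale (phase f 0 g) (\<phi> ?b)) y = lookup (mono_act f' g (\<phi> ?b)) y"
      by simp
    then show ?thesis
      using y g by (simp add: lookup_fscale lookup_mono_act_col in_keys_iff)
  qed
  \<comment> \<open>On elementary column matrices the equal phases read
    \<open>lam (f c * s) = lam ((f' c - y \<alpha> c) * s)\<close> for all \<open>s\<close>.\<close>
  have "f c = f' c - y \<alpha> c" if "inner c" for c
    using phase[OF elementary_col(1)[OF that]]
    by (intro eq_if_lam_mult_eq) (simp add: elementary_col(2)[OF that])
  then have "{c. inner c \<and> f c \<noteq> f' c} \<subseteq> {c. y \<alpha> c \<noteq> 0}"
    by auto
  then show ?thesis
    using rowvecs_finite[OF y_row] finite_subset by blast
qed

end

section \<open>Uncountably many parameter functions\<close>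

lemma uncountable_nat_sets: "uncountable (UNIV :: nat set set)"
proof
  assume "countable (UNIV :: nat set set)"
  then obtain h :: "nat set \<Rightarrow> nat" where "inj h"
    by (auto simp: countable_def)
  then have "surj (inv_into UNIV h)"
    by (rule inj_imp_surj_inv)
  then show False
    using Cantors_theorem[of "UNIV :: nat set"] by auto
qed

text \<open>Inside \<open>A\<close> lies a copy of the grid of pairs \<open>(n, m)\<close>. Let
  \<open>\<chi> S\<close> be the indicator of the columns with \<open>n\<close> in \<open>S\<close>:
  if \<open>S\<close> and \<open>T\<close> disagree at \<open>n\<close>, the functions disagree on
  that whole infinite column.\<close>

lemma ex_almost_different_family:
  assumes "infinite A"
  shows "\<exists>\<chi> :: nat set \<Rightarrow> 'a \<Rightarrow> 'b::zero_neq_one. \<forall>S T. S \<noteq> T \<longrightarrow> infinite {c \<in> A. \<chi> S c \<noteq> \<chi> T c}"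
proof -
  obtain h :: "nat \<Rightarrow> 'a" where h: "inj h" "range h \<subseteq> A"
    using infinite_countable_subset[OF assms] by blast
  define \<chi> :: "nat set \<Rightarrow> 'a \<Rightarrow> 'b" where
    "\<chi> = (\<lambda>S c. if c \<in> h ` prod_encode ` (S \<times> UNIV) then 1 else 0)"
  have val: "\<chi> S (h (prod_encode (n, m))) = (if n \<in> S then 1 else 0)" for S n m
    using h(1) by (auto simp: \<chi>_def inj_image_mem_iff inj_prod_encode dest: injD)
  have "infinite {c \<in> A. \<chi> S c \<noteq> \<chi> T c}" if neq: "S \<noteq> T" for S T
  proof -
    obtain n where n: "(n \<in> S) \<noteq> (n \<in> T)"
      using neq by blast
    have "inj (\<lambda>m. h (prod_encode (n, m)))"
      using h(1) by (auto intro!: injI dest: injD)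
    then have "infinite (range (\<lambda>m. h (prod_encode (n, m))))"
      by (simp add: finite_image_iff)
    moreover have "range (\<lambda>m. h (prod_encode (n, m))) \<subseteq> {c \<in> A. \<chi> S c \<noteq> \<chi> T c}"
      using n h(2) by (auto simp: val)
    ultimately show ?thesis
      using finite_subset by blast
  qed
  then show ?thesis by blast
qed

theorem theorem4p7:
  fixes \<alpha> \<beta> :: "'l::order"
    and lam :: "'r::ring_1 \<Rightarrow> 'f::field"
  assumes "right_primitive lam"
    and "(\<alpha>, \<beta>) \<in> Phi"
    and "infinite {\<gamma>. \<alpha> < \<gamma> \<and> \<gamma> < \<beta>}"
  shows "mclain_sub (row_roots \<alpha> \<beta>) \<lhd> (mclain_ab \<alpha> \<beta> :: ('l, 'r) mat monoid) \<and>
    (\<exists>\<F> :: (('l, 'r) mat, ('l, 'r) mat \<Rightarrow>\<^sub>0 'f) rep set.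
      uncountable \<F> \<and>
      pairwise (\<lambda>V W. \<not> gmodule_iso fscale (mclain_ab \<alpha> \<beta>) V W) \<F> \<and>
      (\<forall>V\<in>\<F>.
        irreducible_gmodule fscale (mclain_ab \<alpha> \<beta>) V \<and>
        lies_over fscale \<alpha> \<beta> lam V \<and>
        completely_reducible fscale (subgrp (mclain_sub (col_roots \<alpha> \<beta>))) V \<and>
        \<not> completely_reducible fscale (subgrp (mclain_sub (row_roots \<alpha> \<beta>))) V \<and>
        \<not> (\<exists>W. irreducible_gsubmodule fscale (subgrp (mclain_sub (row_roots \<alpha> \<beta>))) V W)))"
proof -
  interpret root_character \<alpha> \<beta> lam
    using assms(1,2) by unfold_locales (auto simp: Phi_def)
  have inf: "infinite {c. inner c}"
    using assms(3) by (simp add: inner_def)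
  obtain \<chi> :: "nat set \<Rightarrow> 'l \<Rightarrow> 'r"
    where \<chi>: "\<And>S T. S \<noteq> T \<Longrightarrow> infinite {c \<in> {c. inner c}. \<chi> S c \<noteq> \<chi> T c}"
    using ex_almost_different_family[OF inf] by metis
  let ?V = "\<lambda>S. mono_rep (\<chi> S)"
  have not_iso: "\<not> gmodule_iso fscale (mclain_ab \<alpha> \<beta>) (?V S) (?V T)" if "S \<noteq> T" for S T
    using finite_neq_if_iso[of "\<chi> S" "\<chi> T"] \<chi>[OF that] by auto
  \<comment> \<open>Reflexivity turns non-isomorphism into inequality, so distinct sets give
    distinct modules and the range is uncountable.\<close>
  have "gmodule_iso fscale (mclain_ab \<alpha> \<beta>) (?V S) (?V S)" for S
    unfolding gmodule_iso_def by (intro exI[of _ id]) auto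
  then have "?V S \<noteq> ?V T" if "S \<noteq> T" for S T
    using not_iso[OF that] by auto
  then have "inj ?V"
    by (auto intro!: injI)
  then have "uncountable (range ?V)"
    using uncountable_nat_sets countable_image_inj_on by blast
  moreover have "pairwise (\<lambda>V W. \<not> gmodule_iso fscale (mclain_ab \<alpha> \<beta>) V W) (range ?V)"
  proof (rule pairwiseI)
    fix V W assume "V \<in> range ?V" "W \<in> range ?V" "V \<noteq> W"
    then obtain S T where "V = ?V S" "W = ?V T" "S \<noteq> T" by blast
    then show "\<not> gmodule_iso fscale (mclain_ab \<alpha> \<beta>) V W"
      using not_iso by simp
  qed
  ultimately show ?thesis
    using normal_row irreducible_mono_rep lies_over_mono_rep completely_reducible_col
      not_completely_reducible_row[OF inf] not_irreducible_row[OF inf]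
    by (intro conjI exI[of _ "range ?V"]) auto
qed

end
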